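(* Let $S$ be a Polish space that is locally compact when equipped with the topology induced by a norm $\|\cdot\|$ defined on $S$; let $\mu\in P(S)$ and $\delta>0$. Suppose that the functions $c$ and $f$ satisfy: (A1) $c:S\times S\to\mathbb{R}_+$ is nonnegative and lower semicontinuous with $c(x,y)=0$ if and only if $x=y$; (A2) $f:S\to\mathbb{R}$ is upper semicontinuous and $f\in L^1(d\mu)$; (A3) there exist a nondecreasing function $g:\mathbb{R}_+\to\mathbb{R}_+$ with $g(t)\uparrow\infty$ as $t\to\infty$ and a positive constant $C$ such that $c(x,y)\ge g(\|x-y\|)$ whenever $\|x-y\|>C$; (A4) there exist an increasing function $h:\mathbb{R}_+\to\mathbb{R}_+$ with $h(t)\uparrow\infty$ as $t\to\infty$ and a positive constant $K$ such that $\sup_{x,y\in S}\frac{f(y)-f(x)}{1+h(\|x-y\|)}\le K$; in addition, given $\epsilon>0$, there exists a positive constant $C_\epsilon$ such that $f(y)-f(x)\le\epsilon(1+c(x,y))$ for every $x,y\in S$ with $\|x-y\|>C_\epsilon$. Then, whenever the dual optimal pair $(\lambda^*,\phi_{\lambda^*})$ satisfying $J(\lambda^*,\phi_{\lambda^*})=J<\infty$ is such that $\lambda^*>0$, there exists a primal optimizer $\pi^*\in\Phi_{\mu,\delta}$ satisfying $I(\pi^* )=I=J=J(\lambda^*,\phi_{\lambda^*})$.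
   Context: $P(S)$ is the set of Borel probability measures on $S$; $\Pi(\mu,\nu)$ is the set of Borel probability measures on $S\times S$ with marginals $\mu$ and $\nu$. $\mathcal{U}(S)$ is the universal $\sigma$-algebra of $S$, and $\mathfrak{m}_{\mathcal U}(S;\overline{\mathbb R})$ is the set of measurable functions $(S,\mathcal U(S))\to(\overline{\mathbb R},\mathcal B(\overline{\mathbb R}))$. Integrals of universally measurable functions are with respect to completions. $$\Phi_{\mu,\delta}:=\Big\{\pi\in\bigcup_{\nu\in P(S)}\Pi(\mu,\nu):\int c\,d\pi\le\delta\Big\},\quad I(\pi):=\int f(y)\,d\pi(x,y),\quad I:=\sup\{I(\pi):\pi\in\Phi_{\mu,\delta}\},$$ where by convention the supremum is only over $\pi$ with $\int f^-(y)\,d\pi(x,y)<\infty$, $f^-=\max(-f,0)$. $$\Lambda_{c,f}:=\{(\lambda,\phi):\lambda\ge0,\ \phi\in\mathfrak{m}_{\mathcal U}(S;\overline{\mathbb R}),\ \phi(x)+\lambda c(x,y)\ge f(y)\ \forall x,y\in S\},$$ $$J(\lambda,\phi):=\lambda\delta+\int\phi\,d\mu,\quad J:=\inf\{J(\lambda,\phi):(\lambda,\phi)\in\Lambda_{c,f}\},\quad \phi_\lambda(x):=\sup_{y\in S}\{f(y)-\lambda c(x,y)\}.$$ A dual optimal pair is a pair $(\lambda^*,\phi_{\lambda^*})\in\Lambda_{c,f}$ attaining $J$. *)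

theory Defs
  imports "HOL-Probability.Probability"
begin

definition borel_probs :: "'a::topological_space measure set" where
  "borel_probs = {M. prob_space M \<and> sets M = sets borel}"

definition couplings ::
    "'a::topological_space measure \<Rightarrow> 'a measure \<Rightarrow> ('a \<times> 'a) measure set" where
  "couplings \<mu> \<nu> =
     {\<pi> \<in> borel_probs. distr \<pi> borel fst = \<mu> \<and> distr \<pi> borel snd = \<nu>}"

definition lower_semicontinuous :: "('a::topological_space \<Rightarrow> real) \<Rightarrow> bool" where
  "lower_semicontinuous f \<longleftrightarrow> (\<forall>x. \<forall>a<f x. \<forall>\<^sub>F y in nhds x. a < f y)"

definition upper_semicontinuous :: "('a::topological_space \<Rightarrow> real) \<Rightarrow> bool" where
  "upper_semicontinuous f \<longleftrightarrow> (\<forall>x. \<forall>a>f x. \<forall>\<^sub>F y in nhds x. f y < a)"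

definition universal_algebra :: "'a::topological_space measure" where
  "universal_algebra = sigma UNIV (\<Inter>M\<in>borel_probs. sets (completion M))"

lemma space_universal_algebra: "space universal_algebra = UNIV"
  by (simp add: universal_algebra_def space_measure_of_conv)

lemma sets_universal_algebra:
  "sets (universal_algebra :: 'a::topological_space measure) =
     (\<Inter>M\<in>(borel_probs :: 'a measure set). sets (completion M))"
proof -
  have sp: "space M = UNIV" if "M \<in> borel_probs" for M :: "'a measure"
    using that sets_eq_imp_space_eq[of M borel] by (simp add: borel_probs_def)
  have "sigma_algebra (UNIV :: 'a set)
          (\<Inter>M\<in>(borel_probs :: 'a measure set). sets (completion M))"
    unfolding sigma_algebra_iff2
    by (auto simp: sp[symmetric] intro: sets.countable_nat_UN)
  then show ?thesis
    unfolding universal_algebra_def by (rule sigma_algebra.sets_measure_of_eq)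
qed

text \<open>
  The two parts are never both infinite in the intended uses: in the primal problem the integral of
  the negative part is required to be finite, and in the dual problem \<open>\<phi> \<ge> f\<close> with \<open>f\<close> integrable,
  because \<open>c\<close> vanishes on the diagonal.  (Note that \<open>\<infinity> - \<infinity> = \<infinity>\<close> in \<^typ>\<open>ereal\<close>.)
\<close>
definition ereal_integral :: "'a measure \<Rightarrow> ('a \<Rightarrow> ereal) \<Rightarrow> ereal" where
  "ereal_integral M u =
     enn2ereal (\<integral>\<^sup>+x. e2ennreal (max (u x) 0) \<partial>M)
       - enn2ereal (\<integral>\<^sup>+x. e2ennreal (max (- u x) 0) \<partial>M)"

definition primal_feasible ::
    "('a::topological_space \<Rightarrow> 'a \<Rightarrow> real) \<Rightarrow> 'a measure \<Rightarrow> real \<Rightarrow> ('a \<times> 'a) measure set" where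
  "primal_feasible c \<mu> \<delta> =
     {\<pi> \<in> (\<Union>\<nu>\<in>borel_probs. couplings \<mu> \<nu>).
        (\<integral>\<^sup>+z. ennreal (c (fst z) (snd z)) \<partial>\<pi>) \<le> ennreal \<delta>}"

definition neg_part_finite :: "('a \<Rightarrow> real) \<Rightarrow> ('a \<times> 'a) measure \<Rightarrow> bool" where
  "neg_part_finite f \<pi> \<longleftrightarrow> (\<integral>\<^sup>+z. ennreal (max (- f (snd z)) 0) \<partial>\<pi>) < \<infinity>"

definition primal_obj :: "('a \<Rightarrow> real) \<Rightarrow> ('a \<times> 'a) measure \<Rightarrow> ereal" where
  "primal_obj f \<pi> = ereal_integral \<pi> (\<lambda>z. ereal (f (snd z)))"

definition primal_value ::
    "('a::topological_space \<Rightarrow> 'a \<Rightarrow> real) \<Rightarrow> ('a \<Rightarrow> real) \<Rightarrow> 'a measure \<Rightarrow> real \<Rightarrow> ereal" where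
  "primal_value c f \<mu> \<delta> =
     (SUP \<pi> \<in> {\<pi> \<in> primal_feasible c \<mu> \<delta>. neg_part_finite f \<pi>}. primal_obj f \<pi>)"

definition dual_feasible ::
    "('a::topological_space \<Rightarrow> 'a \<Rightarrow> real) \<Rightarrow> ('a \<Rightarrow> real) \<Rightarrow> (real \<times> ('a \<Rightarrow> ereal)) set" where
  "dual_feasible c f =
     {(lam, \<phi>). 0 \<le> lam \<and> \<phi> \<in> borel_measurable universal_algebra \<and>
        (\<forall>x y. \<phi> x + ereal (lam * c x y) \<ge> ereal (f y))}"

definition dual_obj :: "'a measure \<Rightarrow> real \<Rightarrow> real \<Rightarrow> ('a \<Rightarrow> ereal) \<Rightarrow> ereal" where
  "dual_obj \<mu> \<delta> lam \<phi> = ereal (lam * \<delta>) + ereal_integral (completion \<mu>) \<phi>"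

definition dual_value ::
    "('a::topological_space \<Rightarrow> 'a \<Rightarrow> real) \<Rightarrow> ('a \<Rightarrow> real) \<Rightarrow> 'a measure \<Rightarrow> real \<Rightarrow> ereal" where
  "dual_value c f \<mu> \<delta> = (INF (lam, \<phi>) \<in> dual_feasible c f. dual_obj \<mu> \<delta> lam \<phi>)"

definition phi_fn ::
    "('a \<Rightarrow> 'a \<Rightarrow> real) \<Rightarrow> ('a \<Rightarrow> real) \<Rightarrow> real \<Rightarrow> 'a \<Rightarrow> ereal" where
  "phi_fn c f lam x = (SUP y. ereal (f y - lam * c x y))"

end

theory Submission
  imports Defs
begin

text \<open>
  Complementary slackness says what an optimal plan must look like: it moves mass from \<open>x\<close> only to
  maximizers of \<open>f y - lam * c x y\<close>, and, because \<open>lam > 0\<close>, it spends the whole budget \<open>\<delta>\<close>.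
  Conversely a plan with both properties has \<open>\<integral> f d\<pi> = \<integral> phi_fn c f lam d\<mu> + lam * \<delta>\<close>, the dual value,
  and weak duality (\<open>primal_obj_le_dual\<close>) makes it optimal.  So the task is to build such a plan.

  Local compactness makes closed balls compact, and the growth conditions confine the maximizers of
  \<open>f y - l * c x y\<close>, for all penalties \<open>l\<close> near \<open>lam\<close>, to a ball around \<open>x\<close> of fixed radius
  (\<open>penalized_maximizers_near\<close>).  Hence maximizers exist, their cost is bounded uniformly in \<open>x\<close>, and
  they can be chosen as Borel functions of \<open>x\<close> (\<open>compact_correspondence_selection\<close>); choosing among
  them those of least or of greatest cost is again a maximization
  (\<open>compact_correspondence_argmax\<close>).

  That \<open>lam\<close> minimizes the dual objective among all penalties, with \<open>lam > 0\<close> so that smaller penalties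
  compete as well, forces the budget to lie between the mean costs of the cheapest maximizer \<open>a\<close> and
  of the dearest maximizer \<open>b\<close> (\<open>penalized_argmax_budget\<close>).  Some mixture of the plans
  \<open>(x, a x)\<close> and \<open>(x, b x)\<close> therefore costs exactly \<open>\<delta>\<close> (\<open>graph_mixture_integral\<close>), and this mixture is
  the optimizer.
\<close>

section \<open>Semicontinuous functions\<close>

lemma upper_semicontinuous_iff_closed:
  "upper_semicontinuous u \<longleftrightarrow> (\<forall>a. closed {z. a \<le> u z})"
proof -
  have "closed {z. a \<le> u z} \<longleftrightarrow> open {z. u z < a}" for a
    by (simp add: closed_def Collect_neg_eq[symmetric] not_le)
  moreover have "upper_semicontinuous u \<longleftrightarrow> (\<forall>a. open {z. u z < a})"
  proof
    assume u: "upper_semicontinuous u"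
    show "\<forall>a. open {z. u z < a}"
    proof
      fix a
      have "\<forall>x\<in>{z. u z < a}. eventually (\<lambda>y. y \<in> {z. u z < a}) (nhds x)"
        using u unfolding upper_semicontinuous_def by simp
      then show "open {z. u z < a}"
        by (subst open_subopen) (auto simp: eventually_nhds subset_eq)
    qed
  next
    assume o: "\<forall>a. open {z. u z < a}"
    show "upper_semicontinuous u"
      unfolding upper_semicontinuous_def
    proof (intro allI impI)
      fix x a assume "u x < a"
      then show "\<forall>\<^sub>F y in nhds x. u y < a"
        using eventually_nhds_in_open[of "{z. u z < a}" x] o by simp
    qed
  qed
  ultimately show ?thesis by simp
qed

lemma upper_semicontinuous_uminus:
  assumes "lower_semicontinuous u"
  shows "upper_semicontinuous (\<lambda>z. - u z)"
  unfolding upper_semicontinuous_def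
proof (intro allI impI)
  fix x a assume "- u x < a"
  then have "- a < u x" by simp
  with assms have "\<forall>\<^sub>F y in nhds x. - a < u y"
    unfolding lower_semicontinuous_def by blast
  then show "\<forall>\<^sub>F y in nhds x. - u y < a" by (rule eventually_mono) auto
qed

lemma upper_semicontinuous_add:
  assumes "upper_semicontinuous u" "upper_semicontinuous v"
  shows "upper_semicontinuous (\<lambda>z. u z + v z)"
  unfolding upper_semicontinuous_def
proof (intro allI impI)
  fix x a assume a: "u x + v x < a"
  define e where "e = (a - u x - v x) / 2"
  have "e > 0" using a by (simp add: e_def)
  then have "u x < u x + e" "v x < v x + e" by auto
  with assms have "\<forall>\<^sub>F y in nhds x. u y < u x + e" "\<forall>\<^sub>F y in nhds x. v y < v x + e"
    unfolding upper_semicontinuous_def by blast+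
  then show "\<forall>\<^sub>F y in nhds x. u y + v y < a"
    by eventually_elim (auto simp: e_def field_simps)
qed

lemma upper_semicontinuous_cmult:
  assumes "upper_semicontinuous u" "0 < (k::real)"
  shows "upper_semicontinuous (\<lambda>z. k * u z)"
  unfolding upper_semicontinuous_def
proof (intro allI impI)
  fix x a assume a: "k * u x < a"
  then have "u x < a / k" using assms(2) by (simp add: field_simps)
  with assms(1) have "\<forall>\<^sub>F y in nhds x. u y < a / k"
    unfolding upper_semicontinuous_def by blast
  then show "\<forall>\<^sub>F y in nhds x. k * u y < a"
    by eventually_elim (use assms(2) in \<open>auto simp: field_simps\<close>)
qed

lemma upper_semicontinuous_compose:
  assumes "upper_semicontinuous u" "continuous_on UNIV k"
  shows "upper_semicontinuous (\<lambda>z. u (k z))"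
  unfolding upper_semicontinuous_iff_closed
proof
  fix a
  have "closed {z. a \<le> u z}" using assms(1) by (simp add: upper_semicontinuous_iff_closed)
  then have "closed (k -` {z. a \<le> u z})"
    using assms(2) by (rule closed_vimage)
  then show "closed {z. a \<le> u (k z)}" by (simp add: vimage_def)
qed

lemma upper_semicontinuous_continuous:
  assumes "continuous_on UNIV u"
  shows "upper_semicontinuous u"
  unfolding upper_semicontinuous_iff_closed
proof
  show "closed {z. a \<le> u z}" for a
    by (intro closed_Collect_le continuous_on_const assms)
qed

lemma upper_semicontinuous_borel_measurable:
  assumes "upper_semicontinuous u"
  shows "u \<in> borel_measurable borel"
  unfolding borel_measurable_iff_ge
  using assms by (simp add: upper_semicontinuous_iff_closed)

text \<open>
  The values \<open>u (y n)\<close> need not converge, so the hypothesis is a convergent lower bound \<open>r\<close>; in the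
  application the points \<open>y n\<close> are only approximate maximizers and \<open>r\<close> absorbs the error.
\<close>
lemma upper_semicontinuous_limit_ge:
  assumes u: "upper_semicontinuous u" and y: "y \<longlonglongrightarrow> l"
    and ge: "\<And>n. r n \<le> u (y n)" and r: "r \<longlonglongrightarrow> (a::real)"
  shows "a \<le> u l"
proof (rule dense_le)
  fix b assume "b < a"
  with r have "\<forall>\<^sub>F n in sequentially. b < r n" by (rule order_tendstoD)
  then have "\<forall>\<^sub>F n in sequentially. y n \<in> {z. b \<le> u z}"
    using ge by (auto elim!: eventually_mono intro: order_trans[OF less_imp_le])
  moreover have "closed {z. b \<le> u z}" using u by (simp add: upper_semicontinuous_iff_closed)
  ultimately have "l \<in> {z. b \<le> u z}"
    using y by (intro Lim_in_closed_set[where F = sequentially]) auto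
  then show "b \<le> u l" by simp
qed

lemma upper_semicontinuous_attains_max:
  fixes u :: "'a::topological_space \<Rightarrow> real"
  assumes u: "upper_semicontinuous u" and T: "compact T" "T \<noteq> {}"
  shows "\<exists>y\<in>T. \<forall>y'\<in>T. u y' \<le> u y"
proof (rule ccontr)
  assume "\<not> ?thesis"
  then have cov: "\<And>y. y \<in> T \<Longrightarrow> \<exists>y'\<in>T. u y < u y'" by (auto simp: not_le)
  have "open {y. u y < u z}" for z
    using u by (simp add: upper_semicontinuous_iff_closed closed_def Collect_neg_eq[symmetric] not_le)
  moreover have "T \<subseteq> (\<Union>z\<in>T. {y. u y < u z})" using cov by fast
  ultimately obtain D where D: "D \<subseteq> T" "finite D" "T \<subseteq> (\<Union>z\<in>D. {y. u y < u z})"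
    by (rule compactE_image[OF T(1)])
  then have ne: "D \<noteq> {}" using T(2) by auto
  have "Max (u ` D) \<in> u ` D" using D(2) ne by (intro Max_in) auto
  then obtain z where z: "z \<in> D" "u z = Max (u ` D)" by auto
  with D obtain z' where z': "z' \<in> D" "u z < u z'" by blast
  then have "u z' \<le> Max (u ` D)" using D(2) by (intro Max_ge) auto
  with z z' show False by simp
qed

text \<open>
  Cantor's intersection theorem in a metric space whose bounded closed sets may fail to be compact.
\<close>
lemma compact_decreasing_inter_nonempty:
  fixes F :: "nat \<Rightarrow> 'a::metric_space set"
  assumes F: "\<And>n. compact (F n)" "\<And>n. F n \<noteq> {}" and dec: "\<And>n. F (Suc n) \<subseteq> F n"
  shows "(\<Inter>n. F n) \<noteq> {}"
proof -
  have dec': "m \<le> n \<Longrightarrow> F n \<subseteq> F m" for m n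
    using dec by (rule lift_Suc_antimono_le)
  have "\<forall>n. \<exists>y. y \<in> F n" using F(2) by blast
  then obtain y where y: "\<And>n. y n \<in> F n" by metis
  then have "\<And>n. y n \<in> F 0" using dec' by blast
  then obtain l r where r: "strict_mono r" "(y \<circ> r) \<longlonglongrightarrow> l"
    using F(1)[of 0] unfolding compact_def by metis
  have "l \<in> F n" for n
  proof (rule Lim_in_closed_set[OF _ _ _ r(2)])
    show "closed (F n)" using F(1) by (rule compact_imp_closed)
    have "(y \<circ> r) k \<in> F n" if "k \<ge> n" for k
    proof -
      have "n \<le> r k" using seq_suble[OF r(1), of k] that by linarith
      from dec'[OF this] y[of "r k"] show ?thesis by auto
    qed
    then show "\<forall>\<^sub>F k in sequentially. (y \<circ> r) k \<in> F n"
      unfolding eventually_sequentially by blast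
  qed auto
  then show ?thesis by blast
qed

section \<open>Compact-valued correspondences and their Borel selections\<close>

text \<open>
  The measurability clause tests a correspondence against every closed set \<open>A\<close> of the \<^emph>\<open>product\<close>, not
  only against cylinders \<open>UNIV \<times> K\<close> as in the usual definition of a measurable set-valued map.  The
  stronger test lets the class be stable under maximization of a function of both variables:
  superlevel sets of such a function are closed in the product but are not cylinders.
\<close>
definition compact_correspondence :: "('x::topological_space \<times> 'y::topological_space) set \<Rightarrow> bool" where
  "compact_correspondence \<Gamma> \<longleftrightarrow>
     (\<forall>x. compact (\<Gamma> `` {x}) \<and> \<Gamma> `` {x} \<noteq> {}) \<and>
     (\<forall>A. closed A \<longrightarrow> fst ` (\<Gamma> \<inter> A) \<in> sets borel)"

definition argmax_graph :: "('x \<times> 'y \<Rightarrow> real) \<Rightarrow> ('x \<times> 'y) set \<Rightarrow> ('x \<times> 'y) set" where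
  "argmax_graph u \<Gamma> = {z \<in> \<Gamma>. \<forall>y. (fst z, y) \<in> \<Gamma> \<longrightarrow> u (fst z, y) \<le> u z}"

lemma upper_semicontinuous_section:
  fixes u :: "'x::topological_space \<times> 'y::topological_space \<Rightarrow> real"
  assumes "upper_semicontinuous u"
  shows "upper_semicontinuous (\<lambda>y. u (x, y))"
  by (rule upper_semicontinuous_compose[OF assms]) (intro continuous_intros)

lemma closed_section:
  fixes A :: "('x::topological_space \<times> 'y::topological_space) set"
  assumes "closed A"
  shows "closed {y. (x, y) \<in> A}"
proof -
  have "closed (Pair x -` A)"
    using assms by (rule closed_vimage) (intro continuous_intros)
  then show ?thesis by (simp add: vimage_def)
qed

text \<open>
  Over a point \<open>x\<close>, some maximizer of \<open>u\<close> lies in \<open>A\<close> exactly when the fibre meets \<open>A\<close> and every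
  rational level reached by \<open>u\<close> on the fibre is already reached on the part of the fibre inside \<open>A\<close>.
  These countably many conditions involve only projections of intersections of \<open>\<Gamma>\<close> with closed sets.
\<close>
lemma compact_correspondence_argmax:
  fixes \<Gamma> :: "('x::topological_space \<times> 'y::t2_space) set"
  assumes \<Gamma>: "compact_correspondence \<Gamma>" and u: "upper_semicontinuous u"
  shows "compact_correspondence (argmax_graph u \<Gamma>)"
  unfolding compact_correspondence_def
proof (intro conjI allI impI)
  fix x
  have cpt: "compact (\<Gamma> `` {x})" and ne: "\<Gamma> `` {x} \<noteq> {}"
    using \<Gamma> by (auto simp: compact_correspondence_def)
  obtain y0 where y0: "y0 \<in> \<Gamma> `` {x}" "\<forall>y\<in>\<Gamma> `` {x}. u (x, y) \<le> u (x, y0)"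
    using upper_semicontinuous_attains_max[OF upper_semicontinuous_section[OF u] cpt ne] by blast
  have "argmax_graph u \<Gamma> `` {x} = \<Gamma> `` {x} \<inter> {y. u (x, y0) \<le> u (x, y)}"
    using y0 by (force simp: argmax_graph_def)
  moreover have "closed {y. u (x, y0) \<le> u (x, y)}"
    using upper_semicontinuous_section[OF u, of x] by (simp add: upper_semicontinuous_iff_closed)
  ultimately show "compact (argmax_graph u \<Gamma> `` {x})" using cpt by (simp add: compact_Int_closed)
  show "argmax_graph u \<Gamma> `` {x} \<noteq> {}" using y0 by (auto simp: argmax_graph_def)
next
  fix A :: "('x \<times> 'y) set" assume A: "closed A"
  let ?L = "\<lambda>q. {z. real_of_rat q \<le> u z}"
  have meas: "fst ` (\<Gamma> \<inter> B) \<in> sets borel" if "closed B" for B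
    using \<Gamma> that by (auto simp: compact_correspondence_def)
  have L: "closed (?L q)" for q using u by (simp add: upper_semicontinuous_iff_closed)
  have "fst ` (argmax_graph u \<Gamma> \<inter> A) =
    fst ` (\<Gamma> \<inter> A) \<inter> (\<Inter>q. - fst ` (\<Gamma> \<inter> ?L q) \<union> fst ` (\<Gamma> \<inter> (A \<inter> ?L q)))" (is "_ = ?R")
  proof (intro set_eqI iffI)
    fix x assume "x \<in> fst ` (argmax_graph u \<Gamma> \<inter> A)"
    then obtain y where y: "(x, y) \<in> \<Gamma>" "(x, y) \<in> A"
        "\<And>y'. (x, y') \<in> \<Gamma> \<Longrightarrow> u (x, y') \<le> u (x, y)"
      by (auto simp: argmax_graph_def)
    have "x \<in> fst ` (\<Gamma> \<inter> (A \<inter> ?L q))" if q: "x \<in> fst ` (\<Gamma> \<inter> ?L q)" for q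
    proof -
      from q obtain y' where "(x, y') \<in> \<Gamma>" "real_of_rat q \<le> u (x, y')" by auto
      with y(3)[of y'] have "(x, y) \<in> \<Gamma> \<inter> (A \<inter> ?L q)" using y(1,2) by simp
      then show ?thesis by (rule rev_image_eqI) simp
    qed
    moreover have "x \<in> fst ` (\<Gamma> \<inter> A)"
      using y(1,2) by (intro rev_image_eqI[of "(x, y)"]) auto
    ultimately show "x \<in> ?R" by blast
  next
    fix x assume x: "x \<in> ?R"
    let ?T = "\<Gamma> `` {x} \<inter> {y. (x, y) \<in> A}"
    have cT: "compact ?T"
      using \<Gamma> closed_section[OF A, of x] by (auto simp: compact_correspondence_def compact_Int_closed)
    have "?T \<noteq> {}" using x by auto
    from upper_semicontinuous_attains_max[OF upper_semicontinuous_section[OF u] cT this]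
    obtain y0 where y0: "y0 \<in> ?T" "\<forall>y\<in>?T. u (x, y) \<le> u (x, y0)" ..
    have "u (x, y) \<le> u (x, y0)" if y: "(x, y) \<in> \<Gamma>" for y
    proof (rule ccontr)
      assume "\<not> ?thesis"
      then obtain q where q: "u (x, y0) < real_of_rat q" "real_of_rat q < u (x, y)"
        using of_rat_dense[of "u (x, y0)" "u (x, y)"] by auto
      then have "x \<in> fst ` (\<Gamma> \<inter> ?L q)" using y by (intro rev_image_eqI[of "(x, y)"]) auto
      with x have "x \<in> fst ` (\<Gamma> \<inter> (A \<inter> ?L q))" by blast
      then obtain y' where "(x, y') \<in> \<Gamma>" "(x, y') \<in> A" "real_of_rat q \<le> u (x, y')" by auto
      moreover from this have "u (x, y') \<le> u (x, y0)" using y0(2) by blast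
      ultimately show False using q by linarith
    qed
    with y0 have "(x, y0) \<in> argmax_graph u \<Gamma> \<inter> A" by (auto simp: argmax_graph_def)
    then show "x \<in> fst ` (argmax_graph u \<Gamma> \<inter> A)" by (rule rev_image_eqI) simp
  qed
  also have "\<dots> \<in> sets borel"
  proof (intro sets.Int meas A sets.countable_INT'')
    show "- fst ` (\<Gamma> \<inter> ?L q) \<union> fst ` (\<Gamma> \<inter> (A \<inter> ?L q)) \<in> sets borel" for q
      by (intro sets.Un borel_comp meas L closed_Int A)
  qed auto
  finally show "fst ` (argmax_graph u \<Gamma> \<inter> A) \<in> sets borel" .
qed

text \<open>
  Enumerate a dense set \<open>d\<close> and successively shrink the correspondence to the points that are nearest
  to \<open>d 0\<close>, then to \<open>d 1\<close>, and so on.  Each step is a maximization, so the measurability clause is kept;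
  the fibres decrease to nonempty compact sets; and two points in the final fibre have the same
  distance to every \<open>d n\<close>, hence coincide.  Cantor's intersection theorem also gives that the limit
  meets a closed set exactly when all the stages do, which is the measurability of the selection.
\<close>
theorem compact_correspondence_selection:
  fixes \<Gamma> :: "('x::topological_space \<times> 'y::{metric_space, second_countable_topology}) set"
  assumes \<Gamma>: "compact_correspondence \<Gamma>"
  obtains s where "s \<in> borel_measurable borel" "\<And>x. (x, s x) \<in> \<Gamma>"
proof -
  obtain D :: "'y set" where D: "countable D" "\<And>X. open X \<Longrightarrow> X \<noteq> {} \<Longrightarrow> \<exists>d \<in> D. d \<in> X"
    by (rule countable_dense_setE) blast
  from D(2)[of UNIV] have "D \<noteq> {}" by auto
  define d where "d = from_nat_into D"
  have d: "range d = D" unfolding d_def using D(1) \<open>D \<noteq> {}\<close> by (simp add: range_from_nat_into)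
  define G where "G = rec_nat \<Gamma> (\<lambda>n. argmax_graph (\<lambda>z. - dist (snd z) (d n)))"
  have G0: "G 0 = \<Gamma>" and GS: "G (Suc n) = argmax_graph (\<lambda>z. - dist (snd z) (d n)) (G n)" for n
    by (simp_all add: G_def)
  have G: "compact_correspondence (G n)" for n
    by (induction n) (auto simp: G0 GS \<Gamma> intro!: compact_correspondence_argmax
        upper_semicontinuous_continuous continuous_intros)
  have dec: "G (Suc n) \<subseteq> G n" for n by (auto simp: GS argmax_graph_def)
  have uniq: "y = y'" if y: "\<And>n. (x, y) \<in> G n" and y': "\<And>n. (x, y') \<in> G n" for x y y'
  proof (rule ccontr)
    assume "y \<noteq> y'"
    have eq: "dist y (d n) = dist y' (d n)" for n
      using y[of "Suc n"] y'[of "Suc n"] unfolding GS by (force simp: argmax_graph_def)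
    have "\<exists>d\<in>D. d \<in> ball y (dist y y' / 2)" using \<open>y \<noteq> y'\<close> by (intro D(2)) auto
    then obtain n where n: "dist y (d n) < dist y y' / 2" using d by auto
    with eq[of n] have "dist y' (d n) < dist y y' / 2" by simp
    with n show False using dist_triangle[of y y' "d n"] by (simp add: dist_commute)
  qed
  have fibre: "(\<exists>y. (\<forall>n. (x, y) \<in> G n) \<and> (x, y) \<in> A) \<longleftrightarrow> (\<forall>n. x \<in> fst ` (G n \<inter> A))"
    if A: "closed A" for x A
  proof
    assume r: "\<forall>n. x \<in> fst ` (G n \<inter> A)"
    let ?F = "\<lambda>n. G n `` {x} \<inter> {y. (x, y) \<in> A}"
    have "(\<Inter>n. ?F n) \<noteq> {}"
    proof (rule compact_decreasing_inter_nonempty)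
      show "compact (?F n)" for n
        using G[of n] closed_section[OF A, of x]
        by (auto simp: compact_correspondence_def compact_Int_closed)
      show "?F n \<noteq> {}" for n using r by force
      show "?F (Suc n) \<subseteq> ?F n" for n using dec by auto
    qed
    then show "\<exists>y. (\<forall>n. (x, y) \<in> G n) \<and> (x, y) \<in> A" by auto
  qed force
  have "\<exists>y. \<forall>n. (x, y) \<in> G n" for x
  proof -
    have "x \<in> fst ` (G n \<inter> UNIV)" for n
      using G[of n] by (force simp: compact_correspondence_def)
    then show ?thesis using fibre[of UNIV x] by auto
  qed
  then obtain s where s: "\<And>x n. (x, s x) \<in> G n" by metis
  have closed_preimage: "s -` T \<in> sets borel" if T: "closed T" for T
  proof -
    have "closed (UNIV \<times> T :: ('x \<times> 'y) set)" using T by (intro closed_Times) auto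
    note f = fibre[OF this] and m = this
    have "s -` T = (\<Inter>n. fst ` (G n \<inter> UNIV \<times> T))"
    proof (intro set_eqI iffI)
      fix x assume "x \<in> s -` T"
      then have "\<exists>y. (\<forall>n. (x, y) \<in> G n) \<and> (x, y) \<in> UNIV \<times> T" using s by auto
      then show "x \<in> (\<Inter>n. fst ` (G n \<inter> UNIV \<times> T))" unfolding f by blast
    next
      fix x assume "x \<in> (\<Inter>n. fst ` (G n \<inter> UNIV \<times> T))"
      then obtain y where "\<forall>n. (x, y) \<in> G n" "y \<in> T" using f[of x] by auto
      moreover have "y = s x" using calculation(1) s by (intro uniq) auto
      ultimately show "x \<in> s -` T" by simp
    qed
    also have "\<dots> \<in> sets borel"
    proof (rule sets.countable_INT'')
      show "fst ` (G n \<inter> UNIV \<times> T) \<in> sets borel" for n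
        using G[of n] m unfolding compact_correspondence_def by blast
    qed auto
    finally show ?thesis .
  qed
  have "s \<in> borel_measurable borel"
  proof (rule borel_measurableI)
    fix U :: "'y set" assume "open U"
    then have "s -` (- U) \<in> sets borel" by (intro closed_preimage) auto
    then have "- (s -` (- U)) \<in> sets borel" by (rule borel_comp)
    then show "s -` U \<inter> space borel \<in> sets borel" by (simp add: vimage_Compl)
  qed
  moreover have "(x, s x) \<in> \<Gamma>" for x using s[of x 0] G0 by simp
  ultimately show thesis by (rule that)
qed

text \<open>
  One compact ball around the origin is enough, because all other balls are its affine images.
\<close>
lemma compact_cball_if_locally_compact:
  assumes lc: "locally compact (UNIV :: 'a::real_normed_vector set)"
  shows "compact (cball (x::'a) r)"
proof (cases "0 < r")
  case True
  obtain U V where UV: "open U" "compact V" "(0::'a) \<in> U" "U \<subseteq> V"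
    using locallyE[OF lc, of UNIV 0] by (auto simp: openin_subtopology)
  then obtain e where e: "e > 0" "cball 0 e \<subseteq> V" by (metis open_contains_cball order_trans)
  then have "compact (cball (0::'a) e)"
    using compact_Int_closed[OF UV(2) closed_cball, of 0 e] by (simp add: Int_absorb1)
  then have "compact ((+) x ` (*\<^sub>R) (r / e) ` cball (0::'a) e)"
    by (intro compact_translation compact_scaling)
  moreover have "(+) x ` (*\<^sub>R) (r / e) ` cball (0::'a) e = cball x r"
    using True e by (simp add: cball_scale cball_translation[symmetric])
  ultimately show ?thesis by simp
next
  case False
  then show ?thesis by (cases "r = 0") auto
qed

text \<open>
  The projections are even closed: if \<open>x n\<close> converges and \<open>y n\<close> stays within distance \<open>R\<close> of it, the
  differences \<open>y n - x n\<close> stay in a fixed compact ball.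
\<close>
lemma compact_correspondence_cball:
  assumes lc: "locally compact (UNIV :: 'a::real_normed_vector set)" and R: "0 \<le> R"
  shows "compact_correspondence {(x::'a, y). dist x y \<le> R}"
  unfolding compact_correspondence_def
proof (intro conjI allI impI)
  fix x :: 'a
  have "{(x::'a, y). dist x y \<le> R} `` {x} = cball x R" by auto
  then show "compact ({(x::'a, y). dist x y \<le> R} `` {x})"
    and "{(x::'a, y). dist x y \<le> R} `` {x} \<noteq> {}"
    using compact_cball_if_locally_compact[OF lc] R by auto
next
  fix A :: "('a \<times> 'a) set" assume A: "closed A"
  have "closed (fst ` ({(x, y). dist x y \<le> R} \<inter> A))"
    unfolding closed_sequential_limits
  proof (intro allI impI, elim conjE)
    fix x l assume mem: "\<forall>n. x n \<in> fst ` ({(x, y). dist x y \<le> R} \<inter> A)" and lim: "x \<longlonglongrightarrow> l"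
    have "\<exists>y. dist (x n) y \<le> R \<and> (x n, y) \<in> A" for n using mem[rule_format, of n] by auto
    then obtain y where y: "\<And>n. dist (x n) (y n) \<le> R" "\<And>n. (x n, y n) \<in> A" by metis
    have "y n - x n \<in> cball 0 R" for n using y(1)[of n] by (simp add: dist_norm norm_minus_commute)
    then obtain v r where v: "v \<in> cball 0 R" and r: "strict_mono r"
        and yx: "((\<lambda>n. y n - x n) \<circ> r) \<longlonglongrightarrow> v"
      using compact_cball_if_locally_compact[OF lc, of 0 R] unfolding compact_def by metis
    have xr: "(x \<circ> r) \<longlonglongrightarrow> l" using lim r by (rule LIMSEQ_subseq_LIMSEQ)
    have "(\<lambda>n. (x (r n), y (r n))) \<longlonglongrightarrow> (l, l + v)"
      using tendsto_Pair[OF xr tendsto_add[OF xr yx]] by (simp add: o_def)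
    from closed_sequentially[OF A _ this] have "(l, l + v) \<in> A" using y(2) by blast
    moreover have "dist l (l + v) \<le> R" using v by (simp add: dist_norm)
    ultimately show "l \<in> fst ` ({(x, y). dist x y \<le> R} \<inter> A)"
      by (intro rev_image_eqI[of "(l, l + v)"]) auto
  qed
  then show "fst ` ({(x, y). dist x y \<le> R} \<inter> A) \<in> sets borel" by (rule borel_closed)
qed

section \<open>Maximizers of a penalized objective as the penalty varies\<close>

text \<open>
  Maximizers for the penalties \<open>L n\<close> accumulate only at maximizers for the limit penalty, and along such
  a subsequence \<open>q\<close> converges although it is only lower semicontinuous.  The missing upper bound comes
  from optimality: \<open>lam * q\<close> is \<open>p\<close> minus an almost maximal value, and \<open>p\<close> is upper semicontinuous.
\<close>
lemma argmax_cluster_point: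
  fixes \<Gamma> :: "('x::topological_space \<times> 'y::metric_space) set"
  assumes cpt: "compact (\<Gamma> `` {x})"
    and p: "upper_semicontinuous p" and q: "lower_semicontinuous q"
    and lam: "0 < (lam::real)" and L: "L \<longlonglongrightarrow> lam"
    and Y: "\<And>n. (x, Y n) \<in> argmax_graph (\<lambda>z. p z - L n * q z) \<Gamma>"
    and bound: "\<And>n. \<bar>q (x, Y n)\<bar> \<le> B"
    and y0: "(x, y0) \<in> argmax_graph (\<lambda>z. p z - lam * q z) \<Gamma>" "\<bar>q (x, y0)\<bar> \<le> B"
  obtains r y where "strict_mono r" "(x, y) \<in> argmax_graph (\<lambda>z. p z - lam * q z) \<Gamma>"
    "(\<lambda>n. q (x, Y (r n))) \<longlonglongrightarrow> q (x, y)"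
proof -
  let ?F = "\<lambda>z. p z - lam * q z"
  have Y\<Gamma>: "Y n \<in> \<Gamma> `` {x}" for n using Y[of n] by (simp add: argmax_graph_def)
  then obtain y r where y: "y \<in> \<Gamma> `` {x}" and r: "strict_mono r" and lim: "(Y \<circ> r) \<longlonglongrightarrow> y"
    using cpt unfolding compact_def by metis
  have limY: "(\<lambda>n. Y (r n)) \<longlonglongrightarrow> y" using lim by (simp add: o_def)
  have Lr: "(\<lambda>n. L (r n)) \<longlonglongrightarrow> lam" using LIMSEQ_subseq_LIMSEQ[OF L r] by (simp add: o_def)
  have gap: "(\<lambda>n. 2 * \<bar>L (r n) - lam\<bar> * B) \<longlonglongrightarrow> 0"
    using tendsto_mult_right[OF tendsto_mult_left[OF tendsto_rabs[OF LIM_zero[OF Lr]], of 2], of B]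
    by simp
  \<comment> \<open>\<open>Y n\<close> is optimal for the penalty \<open>L n\<close>; passing to \<open>lam\<close> costs \<open>\<bar>L n - lam\<bar> * B\<close> once for \<open>Y n\<close>
    and once for its competitor \<open>y0\<close>.\<close>
  have near: "?F (x, y0) - 2 * \<bar>L n - lam\<bar> * B \<le> ?F (x, Y n)" for n
  proof -
    have "p (x, y0) - L n * q (x, y0) \<le> p (x, Y n) - L n * q (x, Y n)"
      using Y[of n] y0(1) by (auto simp: argmax_graph_def)
    moreover have "\<bar>(L n - lam) * q (x, y0)\<bar> \<le> \<bar>L n - lam\<bar> * B"
      "\<bar>(L n - lam) * q (x, Y n)\<bar> \<le> \<bar>L n - lam\<bar> * B"
      using bound[of n] y0(2) by (auto simp: abs_mult intro!: mult_left_mono)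
    ultimately show ?thesis by (simp add: algebra_simps abs_le_iff)
  qed
  have F: "upper_semicontinuous (\<lambda>y. ?F (x, y))"
  proof (rule upper_semicontinuous_section)
    have "upper_semicontinuous (\<lambda>z. p z + lam * - q z)"
      by (intro upper_semicontinuous_add upper_semicontinuous_cmult upper_semicontinuous_uminus p q lam)
    then show "upper_semicontinuous ?F" by simp
  qed
  have "?F (x, y0) \<le> ?F (x, y)"
  proof (rule upper_semicontinuous_limit_ge[OF F limY])
    show "?F (x, y0) - 2 * \<bar>L (r n) - lam\<bar> * B \<le> ?F (x, Y (r n))" for n by (rule near)
    show "(\<lambda>n. ?F (x, y0) - 2 * \<bar>L (r n) - lam\<bar> * B) \<longlonglongrightarrow> ?F (x, y0)"
      using tendsto_diff[OF tendsto_const gap, of "?F (x, y0)"] by simp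
  qed
  then have y_max: "(x, y) \<in> argmax_graph ?F \<Gamma>" and val: "?F (x, y) = ?F (x, y0)"
    using y y0(1) by (force simp: argmax_graph_def)+
  have "(\<lambda>n. q (x, Y (r n))) \<longlonglongrightarrow> q (x, y)"
  proof (rule order_tendstoI)
    fix a assume a: "a < q (x, y)"
    have "(\<lambda>n. (x, Y (r n))) \<longlonglongrightarrow> (x, y)" by (intro tendsto_Pair tendsto_const limY)
    moreover have "\<forall>\<^sub>F z in nhds (x, y). a < q z"
      using q a unfolding lower_semicontinuous_def by blast
    ultimately show "\<forall>\<^sub>F n in sequentially. a < q (x, Y (r n))"
      by (rule eventually_compose_filterlim[rotated])
  next
    fix a assume a: "q (x, y) < a"
    define e where "e = lam * (a - q (x, y)) / 2"
    have e: "e > 0" using a lam by (simp add: e_def)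
    have "(\<lambda>n. (x, Y (r n))) \<longlonglongrightarrow> (x, y)" by (intro tendsto_Pair tendsto_const limY)
    moreover have "\<forall>\<^sub>F z in nhds (x, y). p z < p (x, y) + e"
      using p e unfolding upper_semicontinuous_def by (metis less_add_same_cancel1)
    ultimately have "\<forall>\<^sub>F n in sequentially. p (x, Y (r n)) < p (x, y) + e"
      by (rule eventually_compose_filterlim[rotated])
    moreover have "\<forall>\<^sub>F n in sequentially. 2 * \<bar>L (r n) - lam\<bar> * B < e"
      using order_tendstoD(2)[OF gap e] .
    ultimately show "\<forall>\<^sub>F n in sequentially. q (x, Y (r n)) < a"
    proof eventually_elim
      case (elim n)
      have "lam * q (x, Y (r n)) < lam * q (x, y) + 2 * e"
        using elim near[of "r n"] val by linarith
      also have "\<dots> = lam * a" by (simp add: e_def field_simps)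
      finally show ?case using lam by simp
    qed
  qed
  with r y_max show thesis by (rule that)
qed

text \<open>
  Fatou's lemma for bounded functions of either sign, by dominated convergence of
  \<open>min (u n x) (v x)\<close> to \<open>v x\<close>.
\<close>
lemma (in finite_measure) integral_le_if_eventually_minorized:
  fixes u :: "nat \<Rightarrow> 'a \<Rightarrow> real"
  assumes u: "\<And>n. u n \<in> borel_measurable M" and v: "v \<in> borel_measurable M"
    and ub: "\<And>n x. \<bar>u n x\<bar> \<le> B" and vb: "\<And>x. \<bar>v x\<bar> \<le> B"
    and ev: "\<And>x a. a < v x \<Longrightarrow> \<forall>\<^sub>F n in sequentially. a < u n x"
    and le: "\<And>n. (\<integral>x. u n x \<partial>M) \<le> \<delta>"
  shows "(\<integral>x. v x \<partial>M) \<le> \<delta>"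
proof -
  have int_u: "integrable M (u n)" for n
    by (rule integrable_const_bound[where B = B]) (use ub u in auto)
  have "(\<lambda>n. \<integral>x. min (u n x) (v x) \<partial>M) \<longlonglongrightarrow> (\<integral>x. v x \<partial>M)"
  proof (rule integral_dominated_convergence[where w = "\<lambda>_. B"])
    show "AE x in M. (\<lambda>n. min (u n x) (v x)) \<longlonglongrightarrow> v x"
    proof (intro AE_I2 order_tendstoI)
      fix x a assume "a < v x"
      then show "\<forall>\<^sub>F n in sequentially. a < min (u n x) (v x)"
        using ev[of a x] by (auto elim: eventually_mono)
    qed (auto intro!: always_eventually)
    show "AE x in M. norm (min (u n x) (v x)) \<le> B" for n
      using ub[of n] vb by (auto simp: min_def)
  qed (use u v in auto)
  moreover have "(\<integral>x. min (u n x) (v x) \<partial>M) \<le> \<delta>" for n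
  proof -
    have "integrable M (\<lambda>x. min (u n x) (v x))"
      by (rule integrable_const_bound[where B = B]) (use ub[of n] vb u v in \<open>auto simp: min_def\<close>)
    then have "(\<integral>x. min (u n x) (v x) \<partial>M) \<le> (\<integral>x. u n x \<partial>M)"
      using int_u by (intro integral_mono) auto
    with le[of n] show ?thesis by simp
  qed
  ultimately show ?thesis by (intro LIMSEQ_le_const2) auto
qed

lemma borel_measurable_graph:
  fixes s :: "'x::second_countable_topology \<Rightarrow> 'y::second_countable_topology"
  assumes w: "w \<in> borel_measurable borel" and s: "s \<in> borel_measurable borel"
    and M: "sets M = sets borel"
  shows "(\<lambda>x. w (x, s x)) \<in> borel_measurable M"
proof -
  have "(\<lambda>x. (x, s x)) \<in> borel_measurable borel"
    using s by (intro borel_measurable_Pair) auto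
  from measurable_compose[OF this w] show ?thesis
    using measurable_cong_sets[OF M refl] by blast
qed

text \<open>
  The first-order optimality condition at an interior minimum \<open>lam\<close> of the convex function
  \<open>l \<mapsto> l * \<delta> + (\<integral>x. max (p - l * q) \<partial>\<mu>)\<close>: the number \<open>\<delta>\<close> lies between the \<open>q\<close>-integrals of the cheapest
  and of the dearest maximizers, which are minus the right and the left derivative of the integral
  term.  No derivative is taken.  A maximizer for another penalty \<open>l\<close>, tested at \<open>lam\<close>, shows that
  \<open>(l - lam) * (\<delta> - (\<integral>x. q (x, s x) \<partial>\<mu>))\<close> is nonnegative; then \<open>l\<close> tends to \<open>lam\<close> from either side, and
  the cluster points of the maximizers are controlled by \<open>argmax_cluster_point\<close>.  The set of penalties
  \<open>l \<ge> lam / 2\<close> is merely a neighbourhood of \<open>lam\<close> that stays away from zero.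
\<close>
theorem penalized_argmax_budget:
  fixes \<Gamma> :: "('x::second_countable_topology \<times> 'y::{metric_space, second_countable_topology}) set"
    and p q :: "'x \<times> 'y \<Rightarrow> real"
  defines "G \<equiv> \<lambda>l. argmax_graph (\<lambda>z. p z - l * q z) \<Gamma>"
  assumes M: "finite_measure \<mu>" "sets \<mu> = sets borel"
    and \<Gamma>: "compact_correspondence \<Gamma>"
    and p: "upper_semicontinuous p" and q: "lower_semicontinuous q"
    and lam: "0 < lam"
    and bound: "\<And>l x y. lam / 2 \<le> l \<Longrightarrow> (x, y) \<in> G l \<Longrightarrow> \<bar>q (x, y)\<bar> \<le> B"
    and int: "\<And>t. t \<in> borel_measurable borel \<Longrightarrow> (\<And>x. (x, t x) \<in> G lam) \<Longrightarrow>
       integrable \<mu> (\<lambda>x. p (x, t x) - lam * q (x, t x))"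
    and opt: "\<And>l s t. \<lbrakk>lam / 2 \<le> l; s \<in> borel_measurable borel; t \<in> borel_measurable borel;
       \<And>x. (x, s x) \<in> G l; \<And>x. (x, t x) \<in> G lam\<rbrakk> \<Longrightarrow>
       lam * \<delta> + (\<integral>x. p (x, t x) - lam * q (x, t x) \<partial>\<mu>)
       \<le> l * \<delta> + (\<integral>x. p (x, s x) - l * q (x, s x) \<partial>\<mu>)"
  obtains a b where
    "a \<in> borel_measurable borel" "\<And>x. (x, a x) \<in> G lam" "(\<integral>x. q (x, a x) \<partial>\<mu>) \<le> \<delta>"
    "b \<in> borel_measurable borel" "\<And>x. (x, b x) \<in> G lam" "\<delta> \<le> (\<integral>x. q (x, b x) \<partial>\<mu>)"
proof -
  interpret finite_measure \<mu> by (rule M(1))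
  have qm: "q \<in> borel_measurable borel"
    using borel_measurable_uminus[OF upper_semicontinuous_borel_measurable[OF upper_semicontinuous_uminus[OF q]]]
    by simp
  have pm: "p \<in> borel_measurable borel" by (rule upper_semicontinuous_borel_measurable[OF p])
  note graph = borel_measurable_graph[OF _ _ M(2)]
  have G: "compact_correspondence (G l)" if "0 < l" for l
  proof -
    have "upper_semicontinuous (\<lambda>z. p z + l * - q z)"
      by (intro upper_semicontinuous_add upper_semicontinuous_cmult upper_semicontinuous_uminus p q that)
    then have "upper_semicontinuous (\<lambda>z. p z - l * q z)" by simp
    with \<Gamma> show ?thesis unfolding G_def by (rule compact_correspondence_argmax)
  qed
  obtain a where a: "a \<in> borel_measurable borel"
      "\<And>x. (x, a x) \<in> argmax_graph (\<lambda>z. - q z) (G lam)"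
    by (rule compact_correspondence_selection[OF compact_correspondence_argmax[OF G[OF lam]
        upper_semicontinuous_uminus[OF q]]]) blast
  \<comment> \<open>On \<open>G lam\<close> the difference \<open>p - lam * q\<close> is constant along fibres, so maximizing the upper
    semicontinuous \<open>p\<close> there maximizes the lower semicontinuous \<open>q\<close> as well.\<close>
  obtain b where b: "b \<in> borel_measurable borel" "\<And>x. (x, b x) \<in> argmax_graph p (G lam)"
    by (rule compact_correspondence_selection[OF compact_correspondence_argmax[OF G[OF lam] p]]) blast
  have aG: "(x, a x) \<in> G lam" and a_min: "(x, y) \<in> G lam \<Longrightarrow> q (x, a x) \<le> q (x, y)" for x y
    using a(2)[of x] by (auto simp: argmax_graph_def)
  have bG: "(x, b x) \<in> G lam" for x
    using b(2)[of x] by (auto simp: argmax_graph_def)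
  have b_max: "q (x, y) \<le> q (x, b x)" if y: "(x, y) \<in> G lam" for x y
  proof -
    have "p (x, y) - lam * q (x, y) = p (x, b x) - lam * q (x, b x)"
      using y bG[of x] unfolding G_def by (auto simp: argmax_graph_def intro: antisym)
    moreover have "p (x, y) \<le> p (x, b x)"
      using b(2)[of x] y by (auto simp: argmax_graph_def)
    ultimately have "lam * q (x, y) \<le> lam * q (x, b x)" by linarith
    then show ?thesis using lam by simp
  qed
  have int_q: "integrable \<mu> (\<lambda>x. q (x, s x))"
    if "lam / 2 \<le> l" "s \<in> borel_measurable borel" "\<And>x. (x, s x) \<in> G l" for l s
    by (rule integrable_const_bound[where B = B]) (use bound[OF that(1,3)] graph[OF qm that(2)] in auto)
  have variation: "0 \<le> (l - lam) * (\<delta> - (\<integral>x. q (x, s x) \<partial>\<mu>))"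
    if l: "lam / 2 \<le> l" and s: "s \<in> borel_measurable borel" "\<And>x. (x, s x) \<in> G l" for l s
  proof -
    let ?V = "\<lambda>x. p (x, a x) - lam * q (x, a x)" and ?W = "\<lambda>x. p (x, s x) - l * q (x, s x)"
    let ?Q = "\<lambda>x. q (x, s x)"
    have up: "?W x \<le> ?V x - (l - lam) * ?Q x" for x
      using s(2)[of x] aG[of x] unfolding G_def by (auto simp: argmax_graph_def algebra_simps)
    have lo: "?V x - (l - lam) * q (x, a x) \<le> ?W x" for x
      using s(2)[of x] aG[of x] unfolding G_def by (auto simp: argmax_graph_def algebra_simps)
    have iV: "integrable \<mu> ?V" by (rule int[OF a(1) aG])
    have iQ: "integrable \<mu> ?Q" by (rule int_q[OF l s])
    have iA: "integrable \<mu> (\<lambda>x. q (x, a x))" by (rule int_q[OF _ a(1) aG]) (use lam in simp)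
    have iU: "integrable \<mu> (\<lambda>x. ?V x - (l - lam) * ?Q x)" using iV iQ by auto
    have iL: "integrable \<mu> (\<lambda>x. ?V x - (l - lam) * q (x, a x))" using iV iA by auto
    have iW: "integrable \<mu> ?W"
    proof (rule Bochner_Integration.integrable_bound)
      show "integrable \<mu> (\<lambda>x. \<bar>?V x - (l - lam) * ?Q x\<bar> + \<bar>?V x - (l - lam) * q (x, a x)\<bar>)"
        using iU iL by (intro Bochner_Integration.integrable_add integrable_abs)
      show "?W \<in> borel_measurable \<mu>"
        using graph[OF pm s(1)] graph[OF qm s(1)] by (intro borel_measurable_diff borel_measurable_times) auto
      show "AE x in \<mu>. norm (?W x) \<le> norm (\<bar>?V x - (l - lam) * ?Q x\<bar> + \<bar>?V x - (l - lam) * q (x, a x)\<bar>)"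
      proof (rule AE_I2)
        fix x show "norm (?W x) \<le> norm (\<bar>?V x - (l - lam) * ?Q x\<bar> + \<bar>?V x - (l - lam) * q (x, a x)\<bar>)"
          using up[of x] lo[of x] unfolding real_norm_def by linarith
      qed
    qed
    have "(\<integral>x. ?W x \<partial>\<mu>) \<le> (\<integral>x. ?V x - (l - lam) * ?Q x \<partial>\<mu>)"
      by (rule integral_mono[OF iW iU up])
    also have "\<dots> = (\<integral>x. ?V x \<partial>\<mu>) - (l - lam) * (\<integral>x. ?Q x \<partial>\<mu>)"
      using iV iQ by simp
    finally show ?thesis
      using opt[OF l s(1) a(1) s(2) aG] by (simp add: algebra_simps)
  qed
  \<comment> \<open>Maximizers along penalties tending to \<open>lam\<close> have asymptotic cost between those of \<open>a\<close> and \<open>b\<close>.\<close>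
  have approach: "\<exists>s. (\<forall>n. s n \<in> borel_measurable borel \<and> lam / 2 \<le> L n \<and> (\<forall>x. (x, s n x) \<in> G (L n))) \<and>
      (\<forall>x \<alpha>. \<alpha> < q (x, a x) \<longrightarrow> (\<forall>\<^sub>F n in sequentially. \<alpha> < q (x, s n x))) \<and>
      (\<forall>x \<alpha>. q (x, b x) < \<alpha> \<longrightarrow> (\<forall>\<^sub>F n in sequentially. q (x, s n x) < \<alpha>))"
    if L: "\<And>n. lam / 2 \<le> L n" "L \<longlonglongrightarrow> lam" for L :: "nat \<Rightarrow> real"
  proof -
    have "\<exists>s. s \<in> borel_measurable borel \<and> (\<forall>x. (x, s x) \<in> G (L n))" for n
    proof -
      have "0 < L n" using L(1)[of n] lam by linarith
      from compact_correspondence_selection[OF G[OF this]] show ?thesis by metis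
    qed
    then obtain s where s: "\<And>n. s n \<in> borel_measurable borel" "\<And>n x. (x, s n x) \<in> G (L n)"
      by metis
    have cluster: "\<exists>r y. strict_mono r \<and> (x, y) \<in> G lam \<and> (\<lambda>n. q (x, s (k (r n)) x)) \<longlonglongrightarrow> q (x, y)"
      if k: "strict_mono k" for k :: "nat \<Rightarrow> nat" and x
    proof -
      have cpt: "compact (\<Gamma> `` {x})" using \<Gamma> by (simp add: compact_correspondence_def)
      have Lk: "(\<lambda>n. L (k n)) \<longlonglongrightarrow> lam" using LIMSEQ_subseq_LIMSEQ[OF L(2) k] by (simp add: o_def)
      have sk: "(x, s (k n) x) \<in> argmax_graph (\<lambda>z. p z - L (k n) * q z) \<Gamma>" for n
        using s(2) by (simp add: G_def)
      have ba: "\<bar>q (x, a x)\<bar> \<le> B" by (rule bound[OF _ aG]) (use lam in simp)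
      have bs: "\<bar>q (x, s (k n) x)\<bar> \<le> B" for n by (rule bound[OF L(1) s(2)])
      show ?thesis
        by (rule argmax_cluster_point[OF cpt p q lam Lk sk bs aG[unfolded G_def] ba])
          (auto simp: G_def)
    qed
    have below: "\<forall>\<^sub>F n in sequentially. \<alpha> < q (x, s n x)" if "\<alpha> < q (x, a x)" for x \<alpha>
    proof (rule ccontr)
      assume "\<not> ?thesis"
      then have "\<exists>\<^sub>F n in sequentially. q (x, s n x) \<le> \<alpha>" by (simp add: frequently_def not_le)
      then have "infinite {n. q (x, s n x) \<le> \<alpha>}"
        by (simp add: cofinite_eq_sequentially[symmetric] frequently_cofinite)
      then obtain k :: "nat \<Rightarrow> nat" where k: "strict_mono k" "\<And>n. q (x, s (k n) x) \<le> \<alpha>"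
        using infinite_enumerate by blast
      obtain r y where "(x, y) \<in> G lam" "(\<lambda>n. q (x, s (k (r n)) x)) \<longlonglongrightarrow> q (x, y)"
        using cluster[OF k(1)] by blast
      with k(2) have "q (x, y) \<le> \<alpha>" by (intro LIMSEQ_le_const2) auto
      with a_min[OF \<open>(x, y) \<in> G lam\<close>] that show False by linarith
    qed
    have above: "\<forall>\<^sub>F n in sequentially. q (x, s n x) < \<alpha>" if "q (x, b x) < \<alpha>" for x \<alpha>
    proof (rule ccontr)
      assume "\<not> ?thesis"
      then have "\<exists>\<^sub>F n in sequentially. \<alpha> \<le> q (x, s n x)" by (simp add: frequently_def not_le)
      then have "infinite {n. \<alpha> \<le> q (x, s n x)}"
        by (simp add: cofinite_eq_sequentially[symmetric] frequently_cofinite)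
      then obtain k :: "nat \<Rightarrow> nat" where k: "strict_mono k" "\<And>n. \<alpha> \<le> q (x, s (k n) x)"
        using infinite_enumerate by blast
      obtain r y where "(x, y) \<in> G lam" "(\<lambda>n. q (x, s (k (r n)) x)) \<longlonglongrightarrow> q (x, y)"
        using cluster[OF k(1)] by blast
      with k(2) have "\<alpha> \<le> q (x, y)" by (intro LIMSEQ_le_const) auto
      with b_max[OF \<open>(x, y) \<in> G lam\<close>] that show False by linarith
    qed
    from s L(1) below above show ?thesis by blast
  qed
  have step: "(\<lambda>n. lam / (real n + 2)) \<longlonglongrightarrow> 0"
    by (rule real_tendsto_divide_at_top[OF tendsto_const])
      (intro filterlim_tendsto_add_at_top[OF _ filterlim_real_sequentially, where c=2, simplified add.commute] tendsto_const)
  have stepb: "0 < lam / (real n + 2)" "lam / (real n + 2) \<le> lam / 2" for n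
    using lam frac_le[of lam lam 2 "real n + 2"] by auto
  have ba: "\<bar>q (x, a x)\<bar> \<le> B" for x by (rule bound[OF _ aG]) (use lam in simp)
  have bb: "\<bar>q (x, b x)\<bar> \<le> B" for x by (rule bound[OF _ bG]) (use lam in simp)
  have "(\<integral>x. q (x, a x) \<partial>\<mu>) \<le> \<delta>"
  proof -
    let ?L = "\<lambda>n. lam + lam / (real n + 2)"
    have "lam / 2 \<le> ?L n" for n using stepb(1)[of n] lam by linarith
    moreover have "?L \<longlonglongrightarrow> lam" using tendsto_add[OF tendsto_const step, of lam] by simp
    ultimately obtain s where s: "\<And>n. s n \<in> borel_measurable borel" "\<And>n. lam / 2 \<le> ?L n"
        "\<And>n x. (x, s n x) \<in> G (?L n)"
      and ev: "\<And>x \<alpha>. \<alpha> < q (x, a x) \<Longrightarrow> \<forall>\<^sub>F n in sequentially. \<alpha> < q (x, s n x)"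
      using approach[of ?L] by auto
    show ?thesis
    proof (rule integral_le_if_eventually_minorized[where u = "\<lambda>n x. q (x, s n x)" and B = B])
      show "(\<integral>x. q (x, s n x) \<partial>\<mu>) \<le> \<delta>" for n
      proof -
        have "0 \<le> lam / (real n + 2) * (\<delta> - (\<integral>x. q (x, s n x) \<partial>\<mu>))"
          using variation[OF s(2,1,3), of n] by (simp only: add_diff_cancel_left')
        then have "0 \<le> \<delta> - (\<integral>x. q (x, s n x) \<partial>\<mu>)"
          using stepb(1)[of n] by (metis mult_pos_neg not_le)
        then show ?thesis by simp
      qed
      show "\<bar>q (x, s n x)\<bar> \<le> B" for n x by (rule bound[OF s(2,3)])
    qed (use graph[OF qm] s(1) a(1) ba ev in auto)
  qed
  moreover have "\<delta> \<le> (\<integral>x. q (x, b x) \<partial>\<mu>)"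
  proof -
    let ?L = "\<lambda>n. lam - lam / (real n + 2)"
    have "lam / 2 \<le> ?L n" for n using stepb(2)[of n] lam by linarith
    moreover have "?L \<longlonglongrightarrow> lam" using tendsto_diff[OF tendsto_const step, of lam] by simp
    ultimately obtain s where s: "\<And>n. s n \<in> borel_measurable borel" "\<And>n. lam / 2 \<le> ?L n"
        "\<And>n x. (x, s n x) \<in> G (?L n)"
      and ev: "\<And>x \<alpha>. q (x, b x) < \<alpha> \<Longrightarrow> \<forall>\<^sub>F n in sequentially. q (x, s n x) < \<alpha>"
      using approach[of ?L] by auto
    have "(\<integral>x. - q (x, b x) \<partial>\<mu>) \<le> - \<delta>"
    proof (rule integral_le_if_eventually_minorized[where u = "\<lambda>n x. - q (x, s n x)" and B = B])
      show "(\<integral>x. - q (x, s n x) \<partial>\<mu>) \<le> - \<delta>" for n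
      proof -
        have "0 \<le> (?L n - lam) * (\<delta> - (\<integral>x. q (x, s n x) \<partial>\<mu>))"
          by (rule variation[OF s(2,1,3)])
        also have "\<dots> = lam / (real n + 2) * ((\<integral>x. q (x, s n x) \<partial>\<mu>) - \<delta>)"
          by (simp add: algebra_simps)
        finally have "0 \<le> (\<integral>x. q (x, s n x) \<partial>\<mu>) - \<delta>"
          using stepb(1)[of n] by (metis mult_pos_neg not_le)
        then show ?thesis by simp
      qed
      show "\<bar>- q (x, s n x)\<bar> \<le> B" for n x using bound[OF s(2,3)] by simp
      show "\<forall>\<^sub>F n in sequentially. \<alpha> < - q (x, s n x)" if "\<alpha> < - q (x, b x)" for x \<alpha>
        using ev[of x "- \<alpha>"] that by (auto elim: eventually_mono)
    qed (use graph[OF qm] s(1) b(1) bb in auto)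
    then show ?thesis by simp
  qed
  ultimately show thesis using that a(1) aG b(1) bG by blast
qed

section \<open>Primal and dual objectives, weak duality\<close>

lemma ereal_integral_eq_integral:
  assumes "integrable M v"
  shows "ereal_integral M (\<lambda>x. ereal (v x)) = ereal (\<integral>x. v x \<partial>M)"
proof -
  have pos: "(\<integral>\<^sup>+x. e2ennreal (max (ereal (w x)) 0) \<partial>M) = ennreal (\<integral>x. max (w x) 0 \<partial>M)"
    if "integrable M w" for w
  proof -
    have "e2ennreal (max (ereal (w x)) 0) = ennreal (max (w x) 0)" for x
      by (metis e2ennreal_ereal ereal_max zero_ereal_def)
    moreover have "(\<integral>\<^sup>+x. ennreal (max (w x) 0) \<partial>M) = ennreal (\<integral>x. max (w x) 0 \<partial>M)"
      by (rule nn_integral_eq_integral) (use that in auto)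
    ultimately show ?thesis by simp
  qed
  have enn: "enn2ereal (ennreal (\<integral>x. max (w x) 0 \<partial>M)) = ereal (\<integral>x. max (w x) 0 \<partial>M)" for w :: "_ \<Rightarrow> real"
    by (rule enn2ereal_ennreal) (auto intro!: integral_nonneg_AE)
  have "ereal_integral M (\<lambda>x. ereal (v x))
      = ereal ((\<integral>x. max (v x) 0 \<partial>M) - (\<integral>x. max (- v x) 0 \<partial>M))"
    unfolding ereal_integral_def uminus_ereal.simps
    using pos[OF assms] pos[of "\<lambda>x. - v x"] assms by (simp add: enn)
  also have "(\<integral>x. max (v x) 0 \<partial>M) - (\<integral>x. max (- v x) 0 \<partial>M)
      = (\<integral>x. max (v x) 0 - max (- v x) 0 \<partial>M)"
    using assms by (intro Bochner_Integration.integral_diff[symmetric]) auto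
  also have "\<dots> = (\<integral>x. v x \<partial>M)"
    by (intro Bochner_Integration.integral_cong) auto
  finally show ?thesis .
qed

lemma dual_obj_eq_integral:
  assumes "integrable \<mu> v"
  shows "dual_obj \<mu> \<delta> l (\<lambda>x. ereal (v x)) = ereal (l * \<delta> + (\<integral>x. v x \<partial>\<mu>))"
proof -
  have "ereal_integral (completion \<mu>) (\<lambda>x. ereal (v x)) = ereal_integral \<mu> (\<lambda>x. ereal (v x))"
    by (simp add: ereal_integral_def nn_integral_completion)
  with assms show ?thesis by (simp add: dual_obj_def ereal_integral_eq_integral)
qed

lemma borel_measurable_universal_algebra:
  assumes "w \<in> borel_measurable borel"
  shows "w \<in> borel_measurable universal_algebra"
proof (rule borel_measurable_subalgebra[OF _ _ assms])
  show "sets borel \<subseteq> sets (universal_algebra :: 'a measure)"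
    unfolding sets_universal_algebra by (auto simp: borel_probs_def)
qed (simp add: space_universal_algebra)

lemma phi_fn_eq_max:
  assumes "\<And>y. f y - l * c x y \<le> f y0 - l * c x y0"
  shows "phi_fn c f l x = ereal (f y0 - l * c x y0)"
  unfolding phi_fn_def by (intro antisym SUP_least SUP_upper2[of y0]) (use assms in auto)

text \<open>
  Weak duality: integrate \<open>f y \<le> v x + l * c x y\<close> against \<open>\<pi>\<close>.  The finite negative part makes \<open>f (snd z)\<close>
  integrable, as it is dominated from above by an integrable function.
\<close>
lemma primal_obj_le_dual:
  fixes \<mu> :: "'a::second_countable_topology measure"
  assumes \<pi>: "\<pi> \<in> primal_feasible c \<mu> \<delta>" and neg: "neg_part_finite f \<pi>"
    and \<delta>: "0 \<le> \<delta>" and l: "0 \<le> l"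
    and c0: "\<And>x y. 0 \<le> c x y" and c: "(\<lambda>z. c (fst z) (snd z)) \<in> borel_measurable borel"
    and f: "f \<in> borel_measurable borel"
    and v: "v \<in> borel_measurable borel" "integrable \<mu> v"
    and le: "\<And>x y. f y \<le> v x + l * c x y"
  shows "primal_obj f \<pi> \<le> ereal (l * \<delta> + (\<integral>x. v x \<partial>\<mu>))"
proof -
  from \<pi> have sets_\<pi>: "sets \<pi> = sets borel" and marg: "distr \<pi> borel fst = \<mu>"
    and cost: "(\<integral>\<^sup>+z. ennreal (c (fst z) (snd z)) \<partial>\<pi>) \<le> ennreal \<delta>"
    by (auto simp: primal_feasible_def couplings_def borel_probs_def)
  have meas: "w \<in> measurable \<pi> N" if "w \<in> measurable borel N" for w and N :: "'b measure"
    using that measurable_cong_sets[OF sets_\<pi> refl] by blast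
  have fst_m: "fst \<in> measurable \<pi> borel"
    by (rule meas) (intro borel_measurable_continuous_onI continuous_intros)
  have snd_m: "snd \<in> measurable \<pi> borel"
    by (rule meas) (intro borel_measurable_continuous_onI continuous_intros)
  have int_c: "integrable \<pi> (\<lambda>z. c (fst z) (snd z))"
    by (rule integrableI_nonneg) (use meas[OF c] c0 cost in \<open>auto intro: le_less_trans\<close>)
  have "ennreal (\<integral>z. c (fst z) (snd z) \<partial>\<pi>) \<le> ennreal \<delta>"
    using cost nn_integral_eq_integral[OF int_c] c0 by simp
  then have int_c_le: "(\<integral>z. c (fst z) (snd z) \<partial>\<pi>) \<le> \<delta>" using \<delta> by simp
  have int_v: "integrable \<pi> (\<lambda>z. v (fst z))"
    using v(2) unfolding marg[symmetric] by (rule integrable_distr[OF fst_m])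
  have v_eq: "(\<integral>z. v (fst z) \<partial>\<pi>) = (\<integral>x. v x \<partial>\<mu>)"
    unfolding marg[symmetric] by (rule integral_distr[OF fst_m v(1), symmetric])
  have fm: "(\<lambda>z. f (snd z)) \<in> borel_measurable \<pi>" by (rule measurable_compose[OF snd_m f])
  have int_neg: "integrable \<pi> (\<lambda>z. max (- f (snd z)) 0)"
    by (rule integrableI_nonneg) (use fm neg in \<open>auto simp: neg_part_finite_def\<close>)
  have int_up: "integrable \<pi> (\<lambda>z. v (fst z) + l * c (fst z) (snd z))"
    using int_v int_c by auto
  have int_f: "integrable \<pi> (\<lambda>z. f (snd z))"
  proof (rule Bochner_Integration.integrable_bound)
    show "integrable \<pi> (\<lambda>z. \<bar>v (fst z) + l * c (fst z) (snd z)\<bar> + max (- f (snd z)) 0)"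
      by (rule Bochner_Integration.integrable_add[OF integrable_abs[OF int_up] int_neg])
    show "AE z in \<pi>. norm (f (snd z)) \<le> norm (\<bar>v (fst z) + l * c (fst z) (snd z)\<bar> + max (- f (snd z)) 0)"
    proof (rule AE_I2)
      fix z show "norm (f (snd z)) \<le> norm (\<bar>v (fst z) + l * c (fst z) (snd z)\<bar> + max (- f (snd z)) 0)"
        using le[of "snd z" "fst z"] unfolding real_norm_def by linarith
    qed
  qed (rule fm)
  have "(\<integral>z. f (snd z) \<partial>\<pi>) \<le> (\<integral>z. v (fst z) + l * c (fst z) (snd z) \<partial>\<pi>)"
    by (rule integral_mono[OF int_f int_up le])
  also have "\<dots> = (\<integral>x. v x \<partial>\<mu>) + l * (\<integral>z. c (fst z) (snd z) \<partial>\<pi>)"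
    using int_v int_c by (simp add: v_eq)
  also have "\<dots> \<le> l * \<delta> + (\<integral>x. v x \<partial>\<mu>)"
    using mult_left_mono[OF int_c_le l] by simp
  finally show ?thesis
    unfolding primal_obj_def ereal_integral_eq_integral[OF int_f] by simp
qed

section \<open>Mixing two transport maps\<close>

text \<open>
  The law of \<open>(X, Y)\<close> where \<open>X\<close> has law \<open>\<mu>\<close> and \<open>Y\<close> is \<open>b X\<close> or \<open>a X\<close> according to an independent coin
  with success probability \<open>\<theta>\<close>.  Describing the convex combination of two transport plans as an image
  measure reduces its marginals and integrals to the product measure.
\<close>
definition graph_mixture ::
    "'x::topological_space measure \<Rightarrow> real \<Rightarrow> ('x \<Rightarrow> 'y::topological_space) \<Rightarrow> ('x \<Rightarrow> 'y) \<Rightarrow> ('x \<times> 'y) measure" where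
  "graph_mixture \<mu> \<theta> a b =
     distr (\<mu> \<Otimes>\<^sub>M measure_pmf (bernoulli_pmf \<theta>)) borel (\<lambda>(x, i). (x, if i then b x else a x))"

context
  fixes \<mu> :: "'x::second_countable_topology measure" and \<theta> :: real
    and a b :: "'x \<Rightarrow> 'y::second_countable_topology"
  assumes \<mu>: "prob_space \<mu>" "sets \<mu> = sets borel" and \<theta>: "0 \<le> \<theta>" "\<theta> \<le> 1"
    and a: "a \<in> borel_measurable borel" and b: "b \<in> borel_measurable borel"
begin

lemma graph_mixture_map_measurable:
  "(\<lambda>(x, i). (x, if i then b x else a x)) \<in> \<mu> \<Otimes>\<^sub>M measure_pmf (bernoulli_pmf \<theta>) \<rightarrow>\<^sub>M borel"
proof -
  have "a \<in> borel_measurable \<mu>" "b \<in> borel_measurable \<mu>" "(\<lambda>x. x) \<in> borel_measurable \<mu>"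
    using a b measurable_cong_sets[OF \<mu>(2) refl] measurable_ident_sets[OF \<mu>(2)] by auto
  note [measurable] = this
  show ?thesis
    unfolding case_prod_beta by (intro borel_measurable_Pair; measurable)
qed

lemma graph_mixture_borel_prob: "graph_mixture \<mu> \<theta> a b \<in> borel_probs"
proof -
  interpret prob_space \<mu> by (rule \<mu>(1))
  interpret P: pair_prob_space \<mu> "measure_pmf (bernoulli_pmf \<theta>)" ..
  show ?thesis
    unfolding borel_probs_def graph_mixture_def
    using P.prob_space_distr[OF graph_mixture_map_measurable] by simp
qed

lemma graph_mixture_fst: "distr (graph_mixture \<mu> \<theta> a b) borel fst = \<mu>"
proof -
  interpret prob_space \<mu> by (rule \<mu>(1))
  interpret P: pair_prob_space \<mu> "measure_pmf (bernoulli_pmf \<theta>)" ..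
  have "distr (graph_mixture \<mu> \<theta> a b) borel fst
      = distr (\<mu> \<Otimes>\<^sub>M measure_pmf (bernoulli_pmf \<theta>)) borel (fst \<circ> (\<lambda>(x, i). (x, if i then b x else a x)))"
    unfolding graph_mixture_def
    by (intro distr_distr graph_mixture_map_measurable borel_measurable_continuous_onI continuous_intros)
  also have "\<dots> = distr (\<mu> \<Otimes>\<^sub>M measure_pmf (bernoulli_pmf \<theta>)) \<mu> fst"
    using \<mu>(2) by (intro distr_cong) auto
  also have "\<dots> = \<mu>" by (rule measure_pmf.distr_pair_fst)
  finally show ?thesis .
qed

lemma graph_mixture_integral:
  assumes w: "w \<in> borel_measurable borel"
    and int: "integrable \<mu> (\<lambda>x. w (x, a x))" "integrable \<mu> (\<lambda>x. w (x, b x))"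
  shows "integrable (graph_mixture \<mu> \<theta> a b) w"
    and "(\<integral>z. w z \<partial>graph_mixture \<mu> \<theta> a b)
      = \<theta> * (\<integral>x. w (x, b x) \<partial>\<mu>) + (1 - \<theta>) * (\<integral>x. w (x, a x) \<partial>\<mu>)"
proof -
  interpret prob_space \<mu> by (rule \<mu>(1))
  let ?B = "measure_pmf (bernoulli_pmf \<theta>)"
  interpret P: pair_prob_space \<mu> ?B ..
  let ?w = "\<lambda>(x, i). w (x, if i then b x else a x)"
  have wm: "?w \<in> borel_measurable (\<mu> \<Otimes>\<^sub>M ?B)"
    using measurable_compose[OF graph_mixture_map_measurable w] by (simp add: case_prod_beta')
  have iw: "integrable (\<mu> \<Otimes>\<^sub>M ?B) ?w"
  proof (rule Bochner_Integration.integrable_bound)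
    have "integrable (distr (\<mu> \<Otimes>\<^sub>M ?B) \<mu> fst) (\<lambda>x. \<bar>w (x, a x)\<bar> + \<bar>w (x, b x)\<bar>)"
      using int unfolding measure_pmf.distr_pair_fst by auto
    then show "integrable (\<mu> \<Otimes>\<^sub>M ?B) (\<lambda>z. \<bar>w (fst z, a (fst z))\<bar> + \<bar>w (fst z, b (fst z))\<bar>)"
      by (rule integrable_distr[OF measurable_fst])
  qed (use wm in auto)
  show "integrable (graph_mixture \<mu> \<theta> a b) w"
    unfolding graph_mixture_def integrable_distr_eq[OF graph_mixture_map_measurable w]
    using iw by (simp add: case_prod_beta')
  have "(\<integral>z. w z \<partial>graph_mixture \<mu> \<theta> a b) = (\<integral>z. ?w z \<partial>(\<mu> \<Otimes>\<^sub>M ?B))"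
    unfolding graph_mixture_def integral_distr[OF graph_mixture_map_measurable w]
    by (simp add: case_prod_beta')
  also have "\<dots> = (\<integral>x. \<integral>i. w (x, if i then b x else a x) \<partial>?B \<partial>\<mu>)"
    using P.integral_fst'[OF iw] by simp
  also have "\<dots> = (\<integral>x. \<theta> * w (x, b x) + (1 - \<theta>) * w (x, a x) \<partial>\<mu>)"
    using \<theta> by (simp add: mult.commute)
  also have "\<dots> = \<theta> * (\<integral>x. w (x, b x) \<partial>\<mu>) + (1 - \<theta>) * (\<integral>x. w (x, a x) \<partial>\<mu>)"
    using int by simp
  finally show "(\<integral>z. w z \<partial>graph_mixture \<mu> \<theta> a b)
      = \<theta> * (\<integral>x. w (x, b x) \<partial>\<mu>) + (1 - \<theta>) * (\<integral>x. w (x, a x) \<partial>\<mu>)" .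
qed

end

lemma convex_combination_eq:
  fixes u v d :: real
  assumes "u \<le> d" "d \<le> v"
  obtains \<theta> where "0 \<le> \<theta>" "\<theta> \<le> 1" "\<theta> * v + (1 - \<theta>) * u = d"
proof (cases "u = v")
  case True
  with assms show ?thesis by (intro that[of 0]) auto
next
  case False
  with assms have "u < v" by simp
  then show ?thesis
    using assms by (intro that[of "(d - u) / (v - u)"]) (auto simp: divide_simps, simp add: algebra_simps)
qed

section \<open>Existence of a primal optimizer\<close>

text \<open>
  Once \<open>y\<close> is so far from \<open>x\<close> that \<open>c x y > 1\<close>, the growth bound with \<open>\<epsilon> = lam / 4\<close> gives
  \<open>f y - f x < lam / 2 * c x y\<close>: moving that far does not pay even at half the optimal penalty.
\<close>
lemma penalized_maximizers_near:
  fixes c :: "'a::real_normed_vector \<Rightarrow> 'a \<Rightarrow> real"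
  assumes lam: "0 < lam" and c0: "\<And>x y. 0 \<le> c x y"
    and g: "filterlim g at_top at_top" "\<And>x y. C < norm (x - y) \<Longrightarrow> g (norm (x - y)) \<le> c x y"
    and eps: "\<And>\<epsilon>. 0 < \<epsilon> \<Longrightarrow>
        \<exists>C\<^sub>\<epsilon>>0. \<forall>x y. C\<^sub>\<epsilon> < norm (x - y) \<longrightarrow> f y - f x \<le> \<epsilon> * (1 + c x y)"
  obtains R where "0 < R" "\<And>l x y. lam / 2 \<le> l \<Longrightarrow> R < dist x y \<Longrightarrow> f y - l * c x y < f x"
proof -
  obtain C' where C': "C' > 0"
      "\<And>x y. C' < norm (x - y) \<Longrightarrow> f y - f x \<le> lam / 4 * (1 + c x y)"
    using eps[of "lam / 4"] lam by auto
  from g(1) have "\<forall>\<^sub>F t in at_top. 1 < g t" by (simp add: filterlim_at_top_dense)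
  then obtain T where T: "\<And>t. T \<le> t \<Longrightarrow> 1 < g t" by (auto simp: eventually_at_top_linorder)
  show thesis
  proof (rule that[of "max C' (max C T)"])
    show "0 < max C' (max C T)" using C'(1) by simp
    fix l and x y :: 'a assume l: "lam / 2 \<le> l" and far: "max C' (max C T) < dist x y"
    from far have far': "C' < norm (x - y)" "C < norm (x - y)" "T \<le> norm (x - y)"
      by (auto simp: dist_norm)
    have c1: "1 < c x y" using T[OF far'(3)] g(2)[OF far'(2)] by linarith
    have "lam / 4 * (1 + c x y) < lam / 4 * (2 * c x y)"
      using lam c1 by (intro mult_strict_left_mono) auto
    also have "\<dots> = lam / 2 * c x y" by simp
    also have "\<dots> \<le> l * c x y" using l c0 by (rule mult_right_mono)
    finally show "f y - l * c x y < f x" using C'(2)[OF far'(1)] by linarith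
  qed
qed

text \<open>
  Beyond the general results, the proof has to supply a compact correspondence that contains all
  maximizers for the penalties \<open>l \<ge> lam / 2\<close>, bounds on these maximizers that are uniform in \<open>x\<close>, and
  the identification of \<open>phi_fn c f l\<close> with the value along a Borel selection.
\<close>
theorem corollary1:
  fixes \<mu> :: "'a::{real_normed_vector, polish_space} measure"
    and \<delta> :: real
    and c :: "'a \<Rightarrow> 'a \<Rightarrow> real"
    and f :: "'a \<Rightarrow> real"
    and g h :: "real \<Rightarrow> real"
    and C K :: real
    and lam :: real
  assumes S_loc_compact: "locally compact (UNIV :: 'a set)"
    and mu: "\<mu> \<in> borel_probs"
    and delta: "0 < \<delta>"
    and A1_nonneg: "\<And>x y. 0 \<le> c x y"
    and A1_lsc: "lower_semicontinuous (\<lambda>z. c (fst z) (snd z))"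
    and A1_zero: "\<And>x y. c x y = 0 \<longleftrightarrow> x = y"
    and A2_usc: "upper_semicontinuous f"
    and A2_L1: "integrable \<mu> f"
    and A3_g_nonneg: "\<And>t. 0 \<le> t \<Longrightarrow> 0 \<le> g t"
    and A3_g_mono: "mono_on {0..} g"
    and A3_g_lim: "filterlim g at_top at_top"
    and A3_C: "0 < C"
    and A3_bound: "\<And>x y. C < norm (x - y) \<Longrightarrow> g (norm (x - y)) \<le> c x y"
    and A4_h_nonneg: "\<And>t. 0 \<le> t \<Longrightarrow> 0 \<le> h t"
    and A4_h_mono: "mono_on {0..} h"
    and A4_h_lim: "filterlim h at_top at_top"
    and A4_K: "0 < K"
    and A4_bound: "(SUP x. SUP y. ereal ((f y - f x) / (1 + h (norm (x - y))))) \<le> ereal K"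
    and A4_eps: "\<And>\<epsilon>. 0 < \<epsilon> \<Longrightarrow>
        \<exists>C\<^sub>\<epsilon>>0. \<forall>x y. C\<^sub>\<epsilon> < norm (x - y) \<longrightarrow> f y - f x \<le> \<epsilon> * (1 + c x y)"
    and dual_feas: "(lam, phi_fn c f lam) \<in> dual_feasible c f"
    and dual_opt: "dual_obj \<mu> \<delta> lam (phi_fn c f lam) = dual_value c f \<mu> \<delta>"
    and dual_finite: "dual_value c f \<mu> \<delta> < \<infinity>"
    and lam_pos: "0 < lam"
  shows "\<exists>\<pi> \<in> primal_feasible c \<mu> \<delta>.
      neg_part_finite f \<pi> \<and>
      primal_obj f \<pi> = primal_value c f \<mu> \<delta> \<and>
      primal_value c f \<mu> \<delta> = dual_value c f \<mu> \<delta> \<and>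
      dual_value c f \<mu> \<delta> = dual_obj \<mu> \<delta> lam (phi_fn c f lam)"
proof -
  obtain R where R: "0 < R"
      and far: "\<And>l x y. lam / 2 \<le> l \<Longrightarrow> R < dist x y \<Longrightarrow> f y - l * c x y < f x"
    using penalized_maximizers_near[OF lam_pos A1_nonneg A3_g_lim A3_bound A4_eps] by metis
  have prob: "prob_space \<mu>" and sets_\<mu>: "sets \<mu> = sets borel"
    using mu by (auto simp: borel_probs_def)
  interpret prob_space \<mu> by (rule prob)
  \<comment> \<open>Maximizers move mass by at most \<open>R\<close>, so they gain at most \<open>M\<close> over staying at \<open>x\<close>; this bounds
    the excess of the dual potential over \<open>f\<close> and, since \<open>l * c x y\<close> cannot exceed the gain, the cost.\<close>
  define M where "M = K * (1 + h R)"
  have growth: "f y \<le> f x + M" if near: "dist x y \<le> R" for x y :: 'a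
  proof -
    have h: "0 \<le> h (norm (x - y))" "h (norm (x - y)) \<le> h R"
      using A4_h_nonneg mono_onD[OF A4_h_mono, of "norm (x - y)" R] near R by (auto simp: dist_norm)
    have "ereal ((f y - f x) / (1 + h (norm (x - y)))) \<le> ereal K"
      by (rule order_trans[OF _ A4_bound]) (intro SUP_upper2[of x] SUP_upper2[of y] order_refl; simp)
    then have "f y - f x \<le> K * (1 + h (norm (x - y)))"
      using h(1) by (simp add: pos_divide_le_eq)
    also have "\<dots> \<le> M" unfolding M_def using h(2) A4_K by (intro mult_left_mono) auto
    finally show ?thesis by simp
  qed
  define \<Gamma> where "\<Gamma> = {(x::'a, y). dist x y \<le> R}"
  define p where "p = (\<lambda>z :: 'a \<times> 'a. f (snd z))"
  define q where "q = (\<lambda>z. c (fst z) (snd z))"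
  let ?G = "\<lambda>l. argmax_graph (\<lambda>z. p z - l * q z) \<Gamma>"
  have \<Gamma>: "compact_correspondence \<Gamma>"
    unfolding \<Gamma>_def using compact_correspondence_cball[OF S_loc_compact] R by simp
  have p_usc: "upper_semicontinuous p"
    unfolding p_def by (rule upper_semicontinuous_compose[OF A2_usc]) (intro continuous_intros)
  have q_lsc: "lower_semicontinuous q" unfolding q_def by (rule A1_lsc)
  have f_meas: "f \<in> borel_measurable borel" and p_meas: "p \<in> borel_measurable borel"
    by (rule upper_semicontinuous_borel_measurable, fact)+
  have q_meas: "q \<in> borel_measurable borel"
    using borel_measurable_uminus[OF upper_semicontinuous_borel_measurable[OF
        upper_semicontinuous_uminus[OF q_lsc]]] by simp
  note graph = borel_measurable_graph[OF _ _ sets_\<mu>]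

  have in_G: "dist x y \<le> R" "f y' - l * c x y' \<le> f y - l * c x y" "f x \<le> f y - l * c x y"
    if l: "lam / 2 \<le> l" and y: "(x, y) \<in> ?G l" for l x y y'
  proof -
    show "dist x y \<le> R" using y by (simp add: argmax_graph_def \<Gamma>_def)
    have le: "f y' - l * c x y' \<le> f y - l * c x y" if "dist x y' \<le> R" for y'
      using y that by (simp add: argmax_graph_def \<Gamma>_def p_def q_def)
    have "c x x = 0" using A1_zero by blast
    with le[of x] R show self: "f x \<le> f y - l * c x y" by simp
    show "f y' - l * c x y' \<le> f y - l * c x y"
      using le[of y'] far[OF l, of x y'] self by linarith
  qed
  have bound: "\<bar>q (x, y)\<bar> \<le> 2 * M / lam" if l: "lam / 2 \<le> l" and y: "(x, y) \<in> ?G l" for l x y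
  proof -
    have "lam / 2 * c x y \<le> l * c x y" using l A1_nonneg by (rule mult_right_mono)
    also have "\<dots> \<le> M" using in_G(3)[OF l y] growth[OF in_G(1)[OF l y]] by linarith
    finally show ?thesis using lam_pos A1_nonneg[of x y] by (simp add: q_def field_simps)
  qed
  have int: "integrable \<mu> (\<lambda>x. p (x, s x) - l * q (x, s x))"
    if l: "lam / 2 \<le> l" and s: "s \<in> borel_measurable borel" "\<And>x. (x, s x) \<in> ?G l" for l s
  proof (rule Bochner_Integration.integrable_bound)
    show "integrable \<mu> (\<lambda>x. \<bar>f x\<bar> + M)" using A2_L1 by simp
    show "(\<lambda>x. p (x, s x) - l * q (x, s x)) \<in> borel_measurable \<mu>"
      using graph[OF p_meas s(1)] graph[OF q_meas s(1)] by simp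
    show "AE x in \<mu>. norm (p (x, s x) - l * q (x, s x)) \<le> norm (\<bar>f x\<bar> + M)"
    proof (rule AE_I2)
      fix x
      have "0 \<le> l * c x (s x)" using l lam_pos A1_nonneg by (intro mult_nonneg_nonneg) auto
      then show "norm (p (x, s x) - l * q (x, s x)) \<le> norm (\<bar>f x\<bar> + M)"
        using in_G(3)[OF l s(2), of x] growth[OF in_G(1)[OF l s(2)], of x]
        unfolding p_def q_def fst_conv snd_conv real_norm_def by linarith
    qed
  qed
  have phi: "phi_fn c f l = (\<lambda>x. ereal (p (x, s x) - l * q (x, s x)))"
    if l: "lam / 2 \<le> l" and s: "\<And>x. (x, s x) \<in> ?G l" for l s
    using phi_fn_eq_max[of f l c _ "s _", OF in_G(2)[OF l s]] by (auto simp: p_def q_def)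
  have dual: "dual_obj \<mu> \<delta> l (phi_fn c f l) = ereal (l * \<delta> + (\<integral>x. p (x, s x) - l * q (x, s x) \<partial>\<mu>))"
    if l: "lam / 2 \<le> l" and s: "s \<in> borel_measurable borel" "\<And>x. (x, s x) \<in> ?G l" for l s
    unfolding phi[OF l s(2)] by (rule dual_obj_eq_integral[OF int[OF l s]])
  have feasible: "(l, phi_fn c f l) \<in> dual_feasible c f"
    if l: "lam / 2 \<le> l" and s: "s \<in> borel_measurable borel" "\<And>x. (x, s x) \<in> ?G l" for l s
  proof -
    have "(\<lambda>x. p (x, s x) - l * q (x, s x)) \<in> borel_measurable borel"
      using borel_measurable_graph[OF p_meas s(1) refl] borel_measurable_graph[OF q_meas s(1) refl]
      by simp
    then have "phi_fn c f l \<in> borel_measurable universal_algebra"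
      unfolding phi[OF l s(2)] by (intro borel_measurable_universal_algebra borel_measurable_ereal)
    moreover have "ereal (f y) \<le> phi_fn c f l x + ereal (l * c x y)" for x y
      unfolding phi[OF l s(2)] using in_G(2)[OF l s(2), of y x] by (simp add: p_def q_def)
    ultimately show ?thesis using l lam_pos by (simp add: dual_feasible_def)
  qed
  have opt: "lam * \<delta> + (\<integral>x. p (x, t x) - lam * q (x, t x) \<partial>\<mu>)
      \<le> l * \<delta> + (\<integral>x. p (x, s x) - l * q (x, s x) \<partial>\<mu>)"
    if l: "lam / 2 \<le> l" and s: "s \<in> borel_measurable borel" and t: "t \<in> borel_measurable borel"
      and sG: "\<And>x. (x, s x) \<in> ?G l" and tG: "\<And>x. (x, t x) \<in> ?G lam" for l s t
  proof -
    have "dual_obj \<mu> \<delta> lam (phi_fn c f lam) \<le> dual_obj \<mu> \<delta> l (phi_fn c f l)"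
      unfolding dual_opt dual_value_def using feasible[OF l s sG] by (rule INF_lower2) simp
    then show ?thesis using dual[OF l s sG] dual[OF _ t tG] lam_pos by simp
  qed
  have half: "lam / 2 \<le> lam" using lam_pos by simp

  obtain a b where
    a: "a \<in> borel_measurable borel" "\<And>x. (x, a x) \<in> ?G lam" "(\<integral>x. q (x, a x) \<partial>\<mu>) \<le> \<delta>" and
    b: "b \<in> borel_measurable borel" "\<And>x. (x, b x) \<in> ?G lam" "\<delta> \<le> (\<integral>x. q (x, b x) \<partial>\<mu>)"
    by (rule penalized_argmax_budget[OF finite_measure_axioms sets_\<mu> \<Gamma> p_usc q_lsc lam_pos,
          of "2 * M / lam" \<delta>]) (rule that bound int[OF half] opt; simp)+
  obtain \<theta> where \<theta>: "0 \<le> \<theta>" "\<theta> \<le> 1"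
      and budget: "\<theta> * (\<integral>x. q (x, b x) \<partial>\<mu>) + (1 - \<theta>) * (\<integral>x. q (x, a x) \<partial>\<mu>) = \<delta>"
    using convex_combination_eq[OF a(3) b(3)] by blast
  define \<pi> where "\<pi> = graph_mixture \<mu> \<theta> a b"
  note mix = graph_mixture_integral[OF prob sets_\<mu> \<theta> a(1) b(1), folded \<pi>_def]
  \<comment> \<open>The real-valued version of \<open>phi_fn c f lam\<close>.\<close>
  define V where "V = (\<lambda>x. p (x, a x) - lam * q (x, a x))"
  have V_meas: "V \<in> borel_measurable borel"
    unfolding V_def
    using borel_measurable_graph[OF p_meas a(1) refl] borel_measurable_graph[OF q_meas a(1) refl] by simp
  have V_int: "integrable \<mu> V" unfolding V_def by (rule int[OF half a(1,2)])
  have V_max: "f y \<le> V x + lam * c x y" for x y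
    using in_G(2)[OF half a(2), of y x] by (simp add: V_def p_def q_def)
  have pa: "p (x, a x) = V x + lam * q (x, a x)" for x by (simp add: V_def)
  have pb: "p (x, b x) = V x + lam * q (x, b x)" for x
    using in_G(2)[OF half a(2), of "b x" x] in_G(2)[OF half b(2), of "a x" x]
    by (simp add: V_def p_def q_def)
  have q_int: "integrable \<mu> (\<lambda>x. q (x, s x))"
    if "s \<in> borel_measurable borel" "\<And>x. (x, s x) \<in> ?G lam" for s
    by (rule integrable_const_bound[where B = "2 * M / lam"])
      (use bound[OF half that(2)] graph[OF q_meas that(1)] in auto)
  have qa_int: "integrable \<mu> (\<lambda>x. q (x, a x))" and qb_int: "integrable \<mu> (\<lambda>x. q (x, b x))"
    using q_int a b by auto
  have pa_int: "integrable \<mu> (\<lambda>x. p (x, a x))" and pb_int: "integrable \<mu> (\<lambda>x. p (x, b x))"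
    unfolding pa pb using V_int qa_int qb_int by auto
  have cost_int: "integrable \<pi> q" and cost: "(\<integral>z. q z \<partial>\<pi>) = \<delta>"
    using mix[OF q_meas qa_int qb_int] budget by auto
  have obj_int: "integrable \<pi> p" by (rule mix(1)[OF p_meas pa_int pb_int])
  have obj: "(\<integral>z. p z \<partial>\<pi>) = lam * \<delta> + (\<integral>x. V x \<partial>\<mu>)"
  proof -
    have "(\<integral>z. p z \<partial>\<pi>) = \<theta> * ((\<integral>x. V x \<partial>\<mu>) + lam * (\<integral>x. q (x, b x) \<partial>\<mu>))
        + (1 - \<theta>) * ((\<integral>x. V x \<partial>\<mu>) + lam * (\<integral>x. q (x, a x) \<partial>\<mu>))"
      using mix(2)[OF p_meas pa_int pb_int] V_int qa_int qb_int by (simp add: pa pb)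
    also have "\<dots> = (\<integral>x. V x \<partial>\<mu>)
        + lam * (\<theta> * (\<integral>x. q (x, b x) \<partial>\<mu>) + (1 - \<theta>) * (\<integral>x. q (x, a x) \<partial>\<mu>))"
      by (simp add: algebra_simps)
    finally show ?thesis by (simp add: budget)
  qed

  have \<pi>_prob: "\<pi> \<in> borel_probs" and \<pi>_fst: "distr \<pi> borel fst = \<mu>"
    unfolding \<pi>_def
    by (rule graph_mixture_borel_prob graph_mixture_fst; fact prob sets_\<mu> \<theta> a(1) b(1))+
  have "distr \<pi> borel snd \<in> borel_probs"
  proof -
    interpret \<pi>: prob_space \<pi> using \<pi>_prob by (simp add: borel_probs_def)
    have "snd \<in> borel_measurable (borel :: ('a \<times> 'a) measure)"
      by (intro borel_measurable_continuous_onI continuous_intros)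
    then have "snd \<in> borel_measurable \<pi>"
      using \<pi>_prob measurable_cong_sets[of \<pi> borel] by (auto simp: borel_probs_def)
    then show ?thesis by (simp add: borel_probs_def \<pi>.prob_space_distr)
  qed
  then have "\<pi> \<in> (\<Union>\<nu>\<in>borel_probs. couplings \<mu> \<nu>)"
    using \<pi>_prob \<pi>_fst by (auto simp: couplings_def)
  moreover have "(\<integral>\<^sup>+z. ennreal (q z) \<partial>\<pi>) = ennreal \<delta>"
    using nn_integral_eq_integral[OF cost_int] A1_nonneg cost by (simp add: q_def)
  ultimately have \<pi>_feasible: "\<pi> \<in> primal_feasible c \<mu> \<delta>"
    by (simp add: primal_feasible_def q_def)
  have \<pi>_neg: "neg_part_finite f \<pi>"
  proof -
    have i: "integrable \<pi> (\<lambda>z. max (- p z) 0)" using obj_int by auto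
    have "(\<integral>\<^sup>+z. ennreal (max (- p z) 0) \<partial>\<pi>) = ennreal (\<integral>z. max (- p z) 0 \<partial>\<pi>)"
      by (rule nn_integral_eq_integral[OF i]) auto
    then show ?thesis by (simp add: neg_part_finite_def p_def)
  qed
  have dual_eq: "dual_value c f \<mu> \<delta> = ereal (lam * \<delta> + (\<integral>x. V x \<partial>\<mu>))"
    unfolding dual_opt[symmetric] V_def by (rule dual[OF half a(1,2)])
  have \<pi>_obj: "primal_obj f \<pi> = dual_value c f \<mu> \<delta>"
    using ereal_integral_eq_integral[OF obj_int] obj by (simp add: primal_obj_def p_def dual_eq)
  have "primal_value c f \<mu> \<delta> = dual_value c f \<mu> \<delta>"
  proof (rule antisym)
    show "primal_value c f \<mu> \<delta> \<le> dual_value c f \<mu> \<delta>"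
      unfolding primal_value_def dual_eq
      using primal_obj_le_dual[where v = V and l = lam and c = c and f = f] delta lam_pos A1_nonneg
        q_meas f_meas V_meas V_int V_max
      by (intro SUP_least) (auto simp: q_def)
    show "dual_value c f \<mu> \<delta> \<le> primal_value c f \<mu> \<delta>"
      unfolding primal_value_def \<pi>_obj[symmetric] using \<pi>_feasible \<pi>_neg by (intro SUP_upper) simp
  qed
  with \<pi>_feasible \<pi>_neg \<pi>_obj dual_opt show ?thesis by (intro bexI[of _ \<pi>]) auto
qed

end
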